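(* Let $n=2m$ and let $F:\mathbb{S}^m\times\mathbb{H}^m\to\mathbb{H}^{n+1}\subset\mathbb{L}^{n+2}$ be a connected isometric immersion of a cylinder in the hyperbolic space, with inward unit normal vector field $N$ and two distinct principal curvatures $k_{1}>1$ and $k_{2}$, with the same multiplicity $m$, such that $k_{1}k_{2}=1$. Then the solution to the IMCF by parallel hypersurfaces with initial condition $F$ is given by $$F^{t}(x)=\cosh(\mu(t))F(x)+\sinh(\mu(t))N(x),$$ where $$\cosh(2\mu(t))=\frac{-e^{t/m}+a\sqrt{q(t)}}{a^2-1},\qquad \sinh(2\mu(t))=\frac{-a\,e^{t/m}+\sqrt{q(t)}}{a^2-1},$$ $$q(t)=e^{2t/m}+a^2-1,\qquad a=\frac{k_1+k_2}{2}=\frac{H}{n},$$ for all $t\in\mathbb{R}$ and $x\in\mathbb{S}^m\times\mathbb{H}^m$, i.e. $F^t$ is an eternal solution. Moreover, for each $t\in\mathbb{R}$, $F^{t}(\mathbb{S}^m\times\mathbb{H}^m)$ is a cylinder in the hyperbolic space with principal curvatures satisfying $k_1^tk_2^t=1$, which converges to an $m$-dimensional submanifold of $\mathbb{H}^{n+1}$ when $t\to-\infty$ and converges to $\partial\mathbb{H}^{n+1}$ when $t\to+\infty$.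
   Context: $\mathbb{H}^{n+1}=\{x\in\mathbb{L}^{n+2}: -x_1^2+\sum_{i=2}^{n+2}x_i^2=-1,\ x_1>0\}$ in Lorentz space $\mathbb{L}^{n+2}$. For an oriented hypersurface $F:M^n\to\mathbb{H}^{n+1}$ (an immersion) with unit normal $N$, the second fundamental form is $II_x(v,w)=-\langle dN_x(v),dF_x(w)\rangle$, the principal curvatures $k_1,\dots,k_n$ are its eigenvalues with respect to the induced metric, and the mean curvature is $H=\sum_{i=1}^n k_i$ (not averaged; here $H=m(k_1+k_2)$). "Inward" normal means the choice of unit normal for which $H>0$. A cylinder $\mathbb{S}^m\times\mathbb{H}^m$ in $\mathbb{H}^{2m+1}$ is the isoparametric hypersurface which is a product of a round sphere and a hyperbolic space (of suitable constant curvatures), with principal curvature $k_1$ (multiplicity $m$) in the directions tangent to $\mathbb{S}^m$ and $k_2$ (multiplicity $m$) in the directions tangent to $\mathbb{H}^m$, $k_1k_2=1$. $k_1^t,k_2^t$ are the principal curvatures of $F^t$. A one-parameter family of hypersurfaces $F^t:M\to\mathbb{H}^{n+1}$, $t\in I$, with $I\subset\mathbb{R}$ an open interval containing $0$, is a solution to the inverse mean curvature flow (IMCF) with initial condition $F$ if $\frac{\partial F^t}{\partial t}(x)=-\frac{1}{H^t(x)}N^t(x)$ for all $(x,t)\in M\times I$ and $F^0=F$, where $H^t$ is the mean curvature of $F^t$ with respect to its inward unit normal $N^t$ and $H^t(x)>0$ for all $(x,t)$. It is a solution by parallel hypersurfaces if there is a (smooth) function $\mu:I\to\mathbb{R}$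 such that $F^t(x)=\cosh(\mu(t))F(x)+\sinh(\mu(t))N(x)$ for all $t\in I$, $x\in M$; the unit normal of $F^t$ is then $N^t(x)=\sinh(\mu(t))F(x)+\cosh(\mu(t))N(x)$. The solution is eternal if $I=\mathbb{R}$. Let $G:\mathbb{H}^{n+1}\to\mathbb{B}^{n+1}$, $G(x_1,\dots,x_{n+2})=\frac{1}{x_1+1}(x_2,\dots,x_{n+1},-x_{n+2})$, be the isometry onto the Poincaré ball model (the open unit ball of $\mathbb{E}^{n+1}$ with metric $\frac{4}{(1-|x|^2)^2}\langle\cdot,\cdot\rangle$). The conformal boundary $\partial\mathbb{H}^{n+1}$ is the set of ideal points corresponding under $G$ to $\partial\mathbb{B}^{n+1}$. "$F^t(M)$ converges to $\partial\mathbb{H}^{n+1}$ when $t\to+\infty$" means that for every $x\in M$ the Euclidean norm satisfies $|G(F^t(x))|\to1$. Convergence to an $m$-dimensional submanifold is pointwise in $x$: $F^t(x)$ has a limit for every $x$, and the limit map has constant rank $m$, with image an $m$-dimensional submanifold. *)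

theory Defs
  imports "HOL-Analysis.Analysis"
begin

section \<open>Smooth maps and submanifolds of Euclidean spaces\<close>

primrec Ck_on :: "nat \<Rightarrow> 'a::euclidean_space set \<Rightarrow> ('a \<Rightarrow> 'b::euclidean_space) \<Rightarrow> bool" where
  "Ck_on 0 U f \<longleftrightarrow> continuous_on U f"
| "Ck_on (Suc k) U f \<longleftrightarrow>
     (\<forall>x\<in>U. f differentiable (at x)) \<and> (\<forall>v. Ck_on k U (\<lambda>x. frechet_derivative f (at x) v))"

text \<open>\<open>C\<^sup>\<infinity>\<close> maps on a subset of a Euclidean space: locally the restriction of a \<open>C\<^sup>\<infinity>\<close> map on an
  open set. This is smoothness in the usual sense if the subset is open or an embedded submanifold.\<close>

definition smooth_on :: "'a::euclidean_space set \<Rightarrow> ('a \<Rightarrow> 'b::euclidean_space) \<Rightarrow> bool" where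
  "smooth_on S f \<longleftrightarrow>
     (\<forall>p\<in>S. \<exists>U g. open U \<and> p \<in> U \<and> (\<forall>k. Ck_on k U g) \<and> (\<forall>x\<in>S \<inter> U. f x = g x))"

text \<open>Embedded submanifolds of dimension \<open>d\<close>, by local flattening diffeomorphisms.\<close>

definition submanifold :: "nat \<Rightarrow> 'a::euclidean_space set \<Rightarrow> bool" where
  "submanifold d S \<longleftrightarrow>
     (\<forall>p\<in>S. \<exists>U V (\<phi> :: 'a \<Rightarrow> 'a) \<psi> W. open U \<and> p \<in> U \<and> open V \<and>
        homeomorphism U V \<phi> \<psi> \<and> smooth_on U \<phi> \<and> smooth_on V \<psi> \<and>
        subspace W \<and> dim W = d \<and> \<phi> ` (S \<inter> U) = V \<inter> W)"

section \<open>Lorentz space, hyperbolic space and the ball model\<close>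

text \<open>Lorentz space is \<open>real \<times> 'a\<close> with \<open>'a\<close> Euclidean; the first component is the timelike one.\<close>

definition lorentz :: "real \<times> 'a::euclidean_space \<Rightarrow> real \<times> 'a \<Rightarrow> real" where
  "lorentz x y = - (fst x * fst y) + snd x \<bullet> snd y"

definition hyperbolic_space :: "(real \<times> 'a::euclidean_space) set" where
  "hyperbolic_space = {x. lorentz x x = -1 \<and> fst x > 0}"

text \<open>Lorentz space of dimension \<open>n + 2\<close> is \<open>real \<times> ((real ^ 'n) \<times> real)\<close> with \<open>n = CARD('n)\<close>: the three
  components are \<open>x\<^sub>1\<close>, \<open>(x\<^sub>2, \<dots>, x\<^sub>n\<^sub>+\<^sub>1)\<close> and \<open>x\<^sub>n\<^sub>+\<^sub>2\<close>.\<close>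

definition ball_model :: "real \<times> ((real ^ 'n) \<times> real) \<Rightarrow> (real ^ 'n) \<times> real" where
  "ball_model x = (1 / (fst x + 1)) *\<^sub>R (fst (snd x), - snd (snd x))"

section \<open>The manifold \<open>S\<^sup>m \<times> H\<^sup>m\<close>\<close>

type_synonym 'm amb = "(real \<times> (real ^ 'm)) \<times> (real \<times> (real ^ 'm))"

definition SH :: "'m::finite amb set" where
  "SH = sphere 0 1 \<times> hyperbolic_space"

definition tangent_sphere :: "'m::finite amb \<Rightarrow> 'm amb set" where
  "tangent_sphere p = {u. fst p \<bullet> u = 0} \<times> {0}"

definition tangent_hyp :: "'m::finite amb \<Rightarrow> 'm amb set" where
  "tangent_hyp p = {0} \<times> {v. lorentz (snd p) v = 0}"

definition tangent :: "'m::finite amb \<Rightarrow> 'm amb set" where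
  "tangent p = {u. fst p \<bullet> u = 0} \<times> {v. lorentz (snd p) v = 0}"

text \<open>The product of the round metric of curvature \<open>1 / r\<^sup>2\<close> on the sphere and the metric of
  curvature \<open>- 1 / s\<^sup>2\<close> on the hyperbolic space.\<close>

definition product_metric :: "real \<Rightarrow> real \<Rightarrow> 'm::finite amb \<Rightarrow> 'm amb \<Rightarrow> real" where
  "product_metric r s v w = r\<^sup>2 * (fst v \<bullet> fst w) + s\<^sup>2 * lorentz (snd v) (snd w)"

text \<open>The differential. A derivative within \<open>SH\<close> is unique only on \<open>tangent p\<close>, so \<open>differential\<close> is
  meaningful (and used below) only for tangent vectors.\<close>

definition differential ::
    "('m::finite amb \<Rightarrow> 'b::euclidean_space) \<Rightarrow> 'm amb \<Rightarrow> 'm amb \<Rightarrow> 'b" where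
  "differential F p = frechet_derivative F (at p within SH)"

section \<open>Hypersurfaces of hyperbolic space\<close>

definition hypersurface :: "('m::finite amb \<Rightarrow> real \<times> 'a::euclidean_space) \<Rightarrow> bool" where
  "hypersurface F \<longleftrightarrow> smooth_on SH F \<and> F ` SH \<subseteq> hyperbolic_space \<and>
     (\<forall>p\<in>SH. inj_on (differential F p) (tangent p))"

definition unit_normal ::
    "('m::finite amb \<Rightarrow> real \<times> 'a::euclidean_space) \<Rightarrow> ('m amb \<Rightarrow> real \<times> 'a) \<Rightarrow> bool" where
  "unit_normal F N \<longleftrightarrow> smooth_on SH N \<and>
     (\<forall>p\<in>SH. lorentz (N p) (N p) = 1 \<and> lorentz (N p) (F p) = 0 \<and>
        (\<forall>v\<in>tangent p. lorentz (N p) (differential F p v) = 0))"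

definition induced_metric ::
    "('m::finite amb \<Rightarrow> real \<times> 'a::euclidean_space) \<Rightarrow> 'm amb \<Rightarrow> 'm amb \<Rightarrow> 'm amb \<Rightarrow> real" where
  "induced_metric F p v w = lorentz (differential F p v) (differential F p w)"

definition second_fundamental_form ::
    "('m::finite amb \<Rightarrow> real \<times> 'a::euclidean_space) \<Rightarrow> ('m amb \<Rightarrow> real \<times> 'a) \<Rightarrow>
     'm amb \<Rightarrow> 'm amb \<Rightarrow> 'm amb \<Rightarrow> real" where
  "second_fundamental_form F N p v w = - lorentz (differential N p v) (differential F p w)"

definition principal_space ::
    "('m::finite amb \<Rightarrow> real \<times> 'a::euclidean_space) \<Rightarrow> ('m amb \<Rightarrow> real \<times> 'a) \<Rightarrow>
     'm amb \<Rightarrow> real \<Rightarrow> 'm amb set" where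
  "principal_space F N p k =
     {v \<in> tangent p. \<forall>w\<in>tangent p. second_fundamental_form F N p v w = k * induced_metric F p v w}"

definition principal_curvatures ::
    "('m::finite amb \<Rightarrow> real \<times> 'a::euclidean_space) \<Rightarrow> ('m amb \<Rightarrow> real \<times> 'a) \<Rightarrow>
     'm amb \<Rightarrow> real set" where
  "principal_curvatures F N p = {k. \<exists>v\<in>principal_space F N p k. v \<noteq> 0}"

definition mean_curvature ::
    "('m::finite amb \<Rightarrow> real \<times> 'a::euclidean_space) \<Rightarrow> ('m amb \<Rightarrow> real \<times> 'a) \<Rightarrow>
     'm amb \<Rightarrow> real" where
  "mean_curvature F N p =
     (\<Sum>k\<in>principal_curvatures F N p. real (dim (principal_space F N p k)) * k)"

definition inward_unit_normal ::
    "('m::finite amb \<Rightarrow> real \<times> 'a::euclidean_space) \<Rightarrow> ('m amb \<Rightarrow> real \<times> 'a) \<Rightarrow> bool" where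
  "inward_unit_normal F N \<longleftrightarrow> unit_normal F N \<and> (\<forall>p\<in>SH. mean_curvature F N p > 0)"

text \<open>\<open>F\<close> is an isometric immersion of a Riemannian product of a round sphere and a hyperbolic space,
  with constant principal curvatures \<open>k\<^sub>1\<close> along the sphere and \<open>k\<^sub>2\<close> along the hyperbolic space.\<close>

definition cylinder ::
    "('m::finite amb \<Rightarrow> real \<times> 'a::euclidean_space) \<Rightarrow> ('m amb \<Rightarrow> real \<times> 'a) \<Rightarrow>
     real \<Rightarrow> real \<Rightarrow> bool" where
  "cylinder F N k\<^sub>1 k\<^sub>2 \<longleftrightarrow> hypersurface F \<and> unit_normal F N \<and>
     (\<exists>r>0. \<exists>s>0. \<forall>p\<in>SH. \<forall>v\<in>tangent p. \<forall>w\<in>tangent p.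
        induced_metric F p v w = product_metric r s v w) \<and>
     k\<^sub>1 \<noteq> k\<^sub>2 \<and>
     (\<forall>p\<in>SH. principal_curvatures F N p = {k\<^sub>1, k\<^sub>2} \<and>
        principal_space F N p k\<^sub>1 = tangent_sphere p \<and> dim (principal_space F N p k\<^sub>1) = CARD('m) \<and>
        principal_space F N p k\<^sub>2 = tangent_hyp p \<and> dim (principal_space F N p k\<^sub>2) = CARD('m))"

section \<open>Inverse mean curvature flow\<close>

definition imcf_solution ::
    "real set \<Rightarrow> ('m::finite amb \<Rightarrow> real \<times> 'a::euclidean_space) \<Rightarrow>
     (real \<Rightarrow> 'm amb \<Rightarrow> real \<times> 'a) \<Rightarrow> (real \<Rightarrow> 'm amb \<Rightarrow> real \<times> 'a) \<Rightarrow> bool" where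
  "imcf_solution I F Ft Nt \<longleftrightarrow> open I \<and> is_interval I \<and> 0 \<in> I \<and>
     (\<forall>p\<in>SH. Ft 0 p = F p) \<and>
     (\<forall>t\<in>I. hypersurface (Ft t) \<and> inward_unit_normal (Ft t) (Nt t) \<and>
        (\<forall>p\<in>SH. ((\<lambda>s. Ft s p) has_vector_derivative
           - (1 / mean_curvature (Ft t) (Nt t) p) *\<^sub>R Nt t p) (at t)))"

definition parallel_imcf_solution ::
    "real set \<Rightarrow> ('m::finite amb \<Rightarrow> real \<times> 'a::euclidean_space) \<Rightarrow> ('m amb \<Rightarrow> real \<times> 'a) \<Rightarrow>
     (real \<Rightarrow> real) \<Rightarrow> (real \<Rightarrow> 'm amb \<Rightarrow> real \<times> 'a) \<Rightarrow> (real \<Rightarrow> 'm amb \<Rightarrow> real \<times> 'a) \<Rightarrow> bool" where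
  "parallel_imcf_solution I F N \<mu> Ft Nt \<longleftrightarrow> imcf_solution I F Ft Nt \<and> smooth_on I \<mu> \<and>
     (\<forall>t\<in>I. \<forall>p\<in>SH. Ft t p = cosh (\<mu> t) *\<^sub>R F p + sinh (\<mu> t) *\<^sub>R N p)"

text \<open>Pointwise convergence to a limit map of constant rank \<open>d\<close> whose image is a \<open>d\<close>-dimensional
  submanifold of hyperbolic space. As hyperbolic space is itself embedded in Lorentz space, its
  embedded submanifolds are those of Lorentz space that are contained in it.\<close>

definition converges_to_submanifold ::
    "nat \<Rightarrow> (real \<Rightarrow> 'm::finite amb \<Rightarrow> real \<times> 'a::euclidean_space) \<Rightarrow> real filter \<Rightarrow> bool" where
  "converges_to_submanifold d Ft flt \<longleftrightarrow>
     (\<exists>L. (\<forall>p\<in>SH. ((\<lambda>t. Ft t p) \<longlongrightarrow> L p) flt) \<and>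
        smooth_on SH L \<and> (\<forall>p\<in>SH. dim (differential L p ` tangent p) = d) \<and>
        L ` SH \<subseteq> hyperbolic_space \<and> submanifold d (L ` SH))"

definition converges_to_boundary ::
    "(real \<Rightarrow> 'm::finite amb \<Rightarrow> real \<times> ((real ^ 'n) \<times> real)) \<Rightarrow> real filter \<Rightarrow> bool" where
  "converges_to_boundary Ft flt \<longleftrightarrow>
     (\<forall>p\<in>SH. ((\<lambda>t. norm (ball_model (Ft t p))) \<longlongrightarrow> 1) flt)"

end

theory Submission
  imports Defs
begin

text \<open>
  The idea is that everything is controlled by the shape operator of the cylinder. Since
  \<open>F\<close>, \<open>N\<close> and the image of \<open>dF\<close> span Lorentz space (\<open>hypersurface_frame\<close>), the assumption on
  the principal spaces becomes the Weingarten equation \<open>dN = - k\<^sub>1 dF\<close> along the sphere and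
  \<open>dN = - k\<^sub>2 dF\<close> along the hyperbolic factor (\<open>weingarten\<close>). Hence the parallel hypersurface at
  distance \<open>\<sigma>\<close> has the differential \<open>(cosh \<sigma> - k\<^sub>i sinh \<sigma>) dF\<close> on the two factors and the principal
  curvatures \<open>(k\<^sub>i cosh \<sigma> - sinh \<sigma>) / (cosh \<sigma> - k\<^sub>i sinh \<sigma>)\<close>. As \<open>k\<^sub>1 k\<^sub>2 = 1\<close>, their product is
  again \<open>1\<close>, and their sum is \<open>2 (a cosh 2\<sigma> - sinh 2\<sigma>) / (cosh 2\<sigma> - a sinh 2\<sigma>)\<close>.

  A family of parallel hypersurfaces at distance \<open>\<nu> t\<close> thus moves by inverse mean curvature iff
  \<open>\<nu>' = - 1 / H\<close>, and this says that \<open>u = cosh 2\<nu> - a sinh 2\<nu>\<close> satisfies \<open>u' = u / m\<close>. So \<open>u = e\<^sup>t\<^sup>/\<^sup>m\<close>,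
  which determines \<open>\<nu>\<close> because \<open>a > 1\<close> makes \<open>cosh x - a sinh x\<close> decreasing (\<open>flow_unique\<close>). Solving
  for \<open>e\<^sup>2\<^sup>\<nu>\<close> gives the stated formulas, which are meaningful for every \<open>t\<close> (\<open>flow_solution\<close>).

  For \<open>t \<longlongrightarrow> \<infinity>\<close> the distance tends to \<open>-\<infinity>\<close> and the time coordinate of every point diverges
  (\<open>time_component_diverges\<close>). For \<open>t \<longlongrightarrow> -\<infinity>\<close> it tends to the focal distance \<open>\<theta>\<close> with
  \<open>cosh \<theta> = k\<^sub>1 sinh \<theta>\<close>, where the limit is the multiple \<open>sinh \<theta> (k\<^sub>1 F + N)\<close> of a map which, by the
  Weingarten equation, depends on the hyperbolic factor only. Likewise \<open>k\<^sub>2 F + N\<close> depends on the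
  spherical factor only, and the two maps take values in orthogonal subspaces since
  \<open>\<langle>k\<^sub>1 F + N, k\<^sub>2 F + N\<rangle> = 1 - k\<^sub>1 k\<^sub>2 = 0\<close>. So the focal set lies in a totally geodesic subspace of
  dimension \<open>m\<close>. It is open there, by an open mapping argument for the homogeneous extension of
  the sum of the two maps (\<open>cone_map_open\<close>), and totally geodesic subspaces are flattened by an
  explicit diffeomorphism (\<open>submanifold_totally_geodesic\<close>).
\<close>

section \<open>Lorentz geometry\<close>

lemma bounded_bilinear_lorentz: "bounded_bilinear lorentz"
proof -
  have 1: "bounded_bilinear (\<lambda>(x :: real \<times> 'a) (y :: real \<times> 'a). fst x * fst y)"
    by (rule bounded_bilinear.comp[OF bounded_bilinear_mult bounded_linear_fst bounded_linear_fst])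
  have 2: "bounded_bilinear (\<lambda>(x :: real \<times> 'a) (y :: real \<times> 'a). snd x \<bullet> snd y)"
    by (rule bounded_bilinear.comp[OF bounded_bilinear_inner bounded_linear_snd bounded_linear_snd])
  obtain K L where K: "\<forall>(x :: real \<times> 'a) (y :: real \<times> 'a). norm (fst x * fst y) \<le> norm x * norm y * K"
    and L: "\<forall>(x :: real \<times> 'a) (y :: real \<times> 'a). norm (snd x \<bullet> snd y) \<le> norm x * norm y * L"
    using bounded_bilinear.bounded[OF 1] bounded_bilinear.bounded[OF 2] by metis
  show ?thesis
  proof
    show "\<exists>K. \<forall>(x :: real \<times> 'a) (y :: real \<times> 'a). norm (lorentz x y) \<le> norm x * norm y * K"
    proof (intro exI[of _ "K + L"] allI)
      fix x y :: "real \<times> 'a"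
      have "norm (lorentz x y) \<le> norm (fst x * fst y) + norm (snd x \<bullet> snd y)"
        by (simp add: lorentz_def)
      also have "\<dots> \<le> norm x * norm y * K + norm x * norm y * L"
        by (intro add_mono K[rule_format] L[rule_format])
      finally show "norm (lorentz x y) \<le> norm x * norm y * (K + L)"
        by (simp add: distrib_left)
    qed
  qed (simp_all add: lorentz_def algebra_simps inner_add_left inner_add_right)
qed

interpretation lorentz: bounded_bilinear lorentz
  by (rule bounded_bilinear_lorentz)

lemmas lorentz_bilinear = lorentz.add_left lorentz.add_right lorentz.diff_left lorentz.diff_right
  lorentz.minus_left lorentz.minus_right lorentz.scaleR_left lorentz.scaleR_right
  lorentz.zero_left lorentz.zero_right

lemma lorentz_commute: "lorentz x y = lorentz y x"
  by (simp add: lorentz_def inner_commute mult.commute)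

lemma lorentz_nondegenerate:
  assumes "\<And>y. lorentz x y = 0"
  shows "x = 0"
proof -
  have "lorentz x (- fst x, snd x) = fst x * fst x + snd x \<bullet> snd x"
    by (simp add: lorentz_def)
  then have "fst x * fst x + snd x \<bullet> snd x = 0"
    using assms by simp
  then have "x \<bullet> x = 0"
    by (simp add: inner_prod_def)
  then show ?thesis by simp
qed

lemma hyperbolic_spaceD:
  assumes "y \<in> hyperbolic_space"
  shows "lorentz y y = -1" "fst y > 0" "(fst y)\<^sup>2 = 1 + (norm (snd y))\<^sup>2" "norm (snd y) < fst y"
proof -
  show 1: "lorentz y y = -1" "fst y > 0"
    using assms by (auto simp: hyperbolic_space_def)
  then show 2: "(fst y)\<^sup>2 = 1 + (norm (snd y))\<^sup>2"
    by (simp add: lorentz_def power2_eq_square dot_square_norm)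
  show "norm (snd y) < fst y"
    by (rule power2_less_imp_less) (use 1 2 in auto)
qed

text \<open>Reversed Cauchy--Schwarz: a vector \<open>w\<close> orthogonal to \<open>y\<close> has \<open>y\<^sub>1 w\<^sub>1\<close> equal to a Euclidean inner
  product of the space components, and those of \<open>y\<close> are shorter than \<open>y\<^sub>1\<close>.\<close>

lemma lorentz_orthogonal_spacelike:
  assumes "y \<in> hyperbolic_space" "lorentz y w = 0" "w \<noteq> 0"
  shows "lorentz w w > 0"
proof -
  note y = hyperbolic_spaceD[OF assms(1)]
  have eq: "fst y * fst w = snd y \<bullet> snd w"
    using assms(2) by (simp add: lorentz_def)
  have "snd w \<noteq> 0"
  proof
    assume "snd w = 0"
    then have "fst w = 0" using eq y(2) by simp
    with \<open>snd w = 0\<close> show False using assms(3) by (simp add: prod_eq_iff)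
  qed
  then have "fst y * \<bar>fst w\<bar> < fst y * norm (snd w)"
  proof -
    assume nz: "snd w \<noteq> 0"
    have "fst y * \<bar>fst w\<bar> = \<bar>snd y \<bullet> snd w\<bar>"
      using eq y(2) by (metis abs_mult abs_of_pos)
    also have "\<dots> \<le> norm (snd y) * norm (snd w)" by (rule Cauchy_Schwarz_ineq2)
    also have "\<dots> < fst y * norm (snd w)" using y(4) nz by simp
    finally show ?thesis .
  qed
  then have "\<bar>fst w\<bar> < norm (snd w)" using y(2) by simp
  then have "(fst w)\<^sup>2 < (norm (snd w))\<^sup>2"
    by (metis abs_ge_zero power2_abs power_strict_mono zero_less_numeral)
  then show ?thesis
    by (simp add: lorentz_def power2_eq_square dot_square_norm)
qed

lemma lorentz_orthogonal_nonneg: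
  assumes "y \<in> hyperbolic_space" "lorentz y w = 0"
  shows "lorentz w w \<ge> 0"
  using lorentz_orthogonal_spacelike[OF assms] by (cases "w = 0") (auto simp: lorentz_bilinear)

lemma lorentz_hyperbolic_neg:
  assumes "x \<in> hyperbolic_space" "y \<in> hyperbolic_space"
  shows "lorentz x y < 0"
proof -
  have "snd x \<bullet> snd y \<le> norm (snd x) * norm (snd y)" by (rule norm_cauchy_schwarz)
  also have "\<dots> < fst x * fst y"
    using hyperbolic_spaceD[OF assms(1)] hyperbolic_spaceD[OF assms(2)]
    by (intro mult_strict_mono) auto
  finally show ?thesis by (simp add: lorentz_def)
qed

text \<open>Two timelike vectors lie in the same half of the light cone iff their product is negative, so
  the sign of one product decides the condition on the time coordinate.\<close>

lemma hyperbolic_space_sign: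
  assumes "x \<in> hyperbolic_space" "lorentz y y = -1" "lorentz x y \<le> 0"
  shows "y \<in> hyperbolic_space"
proof (rule ccontr)
  assume n: "y \<notin> hyperbolic_space"
  have "fst y \<noteq> 0"
  proof
    assume "fst y = 0"
    then have "snd y \<bullet> snd y = -1" using assms(2) by (simp add: lorentz_def)
    then show False using inner_ge_zero[of "snd y"] by linarith
  qed
  with n assms(2) have "fst y < 0" by (auto simp: hyperbolic_space_def)
  then have "- y \<in> hyperbolic_space"
    using assms(2) by (simp add: hyperbolic_space_def lorentz.minus_left lorentz.minus_right)
  from lorentz_hyperbolic_neg[OF assms(1) this] show False
    using assms(3) by (simp add: lorentz.minus_right)
qed

lemma hyperbolic_space_parallel:
  assumes "x \<in> hyperbolic_space" "lorentz w w = 1" "lorentz w x = 0"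
  shows "cosh s *\<^sub>R x + sinh s *\<^sub>R w \<in> hyperbolic_space"
proof (rule hyperbolic_space_sign[OF assms(1)])
  have x: "lorentz x x = -1" using assms(1) by (simp add: hyperbolic_space_def)
  have xw: "lorentz x w = 0" using assms(3) by (simp add: lorentz_commute)
  show "lorentz (cosh s *\<^sub>R x + sinh s *\<^sub>R w) (cosh s *\<^sub>R x + sinh s *\<^sub>R w) = -1"
    using x xw assms(2,3) hyperbolic_pythagoras[of s]
    by (simp add: lorentz.add_left lorentz.add_right lorentz.scaleR_left lorentz.scaleR_right
        power2_eq_square algebra_simps)
  show "lorentz x (cosh s *\<^sub>R x + sinh s *\<^sub>R w) \<le> 0"
    using x xw by (simp add: lorentz.add_right lorentz.scaleR_right)
qed

text \<open>The initial velocity is the component of \<open>y'\<close> orthogonal to \<open>y\<close>, normalized; \<open>\<theta>\<close> is the distance.\<close>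

lemma hyperbolic_geodesic_to:
  assumes "y \<in> hyperbolic_space" "y' \<in> hyperbolic_space" "y' \<noteq> y"
  obtains w \<theta> where "lorentz w w = 1" "lorentz y w = 0" "y' = cosh \<theta> *\<^sub>R y + sinh \<theta> *\<^sub>R w"
proof -
  define c where "c = - lorentz y y'"
  define w where "w = y' - c *\<^sub>R y"
  have y: "lorentz y y = -1" "lorentz y' y' = -1"
    using assms by (simp_all add: hyperbolic_space_def)
  have c: "c > 0" using lorentz_hyperbolic_neg[OF assms(1,2)] by (simp add: c_def)
  have yw: "lorentz y w = 0"
    by (simp add: w_def c_def lorentz_bilinear y)
  have ww: "lorentz w w = c\<^sup>2 - 1"
    by (simp add: w_def lorentz_bilinear y lorentz_commute[of y' y] power2_eq_square c_def)
  have "w \<noteq> 0"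
  proof
    assume "w = 0"
    then have "c\<^sup>2 = 1" using ww by (simp add: lorentz_bilinear)
    then have "c = 1" using c by (simp add: power2_eq_1_iff)
    with \<open>w = 0\<close> assms(3) show False by (simp add: w_def)
  qed
  then have pos: "c\<^sup>2 - 1 > 0"
    using lorentz_orthogonal_spacelike[OF assms(1) yw] ww by simp
  then have c1: "c \<ge> 1" using c by (smt (verit) power_le_one)
  define \<theta> where "\<theta> = arcosh c"
  have ch: "cosh \<theta> = c" using c1 by (simp add: \<theta>_def)
  have sh: "(sinh \<theta>)\<^sup>2 = c\<^sup>2 - 1" using ch by (simp add: sinh_square_eq)
  then have shnz: "sinh \<theta> \<noteq> 0" using pos by auto
  show thesis
  proof (rule that)
    show "lorentz ((1 / sinh \<theta>) *\<^sub>R w) ((1 / sinh \<theta>) *\<^sub>R w) = 1"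
      using sh shnz pos by (simp add: lorentz.scaleR_left lorentz.scaleR_right ww
          power2_eq_square[symmetric] flip: power_divide)
    show "lorentz y ((1 / sinh \<theta>) *\<^sub>R w) = 0"
      by (simp add: lorentz.scaleR_right yw)
    show "y' = cosh \<theta> *\<^sub>R y + sinh \<theta> *\<^sub>R ((1 / sinh \<theta>) *\<^sub>R w)"
      using shnz by (simp add: ch w_def)
  qed
qed

lemma sphere_great_circle_to:
  fixes x x' :: "'a::real_inner"
  assumes "norm x = 1" "norm x' = 1" "x' \<noteq> x" "x' \<noteq> - x"
  obtains u \<theta> where "norm u = 1" "x \<bullet> u = 0" "x' = cos \<theta> *\<^sub>R x + sin \<theta> *\<^sub>R u"
proof -
  define c where "c = x \<bullet> x'"
  define w where "w = x' - c *\<^sub>R x"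
  have x: "x \<bullet> x = 1" "x' \<bullet> x' = 1" using assms by (simp_all add: dot_square_norm)
  have xw: "x \<bullet> w = 0" by (simp add: w_def inner_diff_right x c_def)
  have ww: "w \<bullet> w = 1 - c\<^sup>2"
    by (simp add: w_def inner_diff_right inner_diff_left x inner_commute[of x' x]
        power2_eq_square c_def algebra_simps)
  have "w \<noteq> 0"
  proof
    assume "w = 0"
    then have "c\<^sup>2 = 1" using ww by simp
    then have "c = 1 \<or> c = -1" by (simp add: power2_eq_1_iff)
    with \<open>w = 0\<close> assms show False by (auto simp: w_def)
  qed
  have "c\<^sup>2 + (norm w)\<^sup>2 = 1" using ww by (simp add: dot_square_norm)
  then obtain \<theta> where \<theta>: "c = cos \<theta>" "norm w = sin \<theta>"
    by (metis sincos_total_2pi)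
  show thesis
  proof (rule that)
    show "norm ((1 / norm w) *\<^sub>R w) = 1" using \<open>w \<noteq> 0\<close> by simp
    show "x \<bullet> (1 / norm w) *\<^sub>R w = 0" by (simp add: xw)
    show "x' = cos \<theta> *\<^sub>R x + sin \<theta> *\<^sub>R (1 / norm w) *\<^sub>R w"
      using \<open>w \<noteq> 0\<close> by (simp flip: \<theta>) (simp add: w_def)
  qed
qed

section \<open>Calculus of \<open>C\<^sup>k\<close> maps\<close>

lemma Ck_on_subset:
  assumes "Ck_on k U f" "V \<subseteq> U"
  shows "Ck_on k V f"
  using assms by (induction k arbitrary: f) (auto intro: continuous_on_subset)

lemma Ck_on_cong:
  assumes "open U" "\<And>x. x \<in> U \<Longrightarrow> f x = g x" "Ck_on k U f"
  shows "Ck_on k U g"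
  using assms(2,3)
proof (induction k arbitrary: f g)
  case 0
  then show ?case using continuous_on_cong by force
next
  case (Suc k)
  have d: "(g has_derivative frechet_derivative f (at x)) (at x)" if "x \<in> U" for x
  proof (rule has_derivative_transform_within_open[OF _ assms(1) that])
    show "(f has_derivative frechet_derivative f (at x)) (at x)"
      using Suc.prems(2) that by (simp flip: frechet_derivative_works)
  qed (use Suc.prems(1) in auto)
  have e: "frechet_derivative g (at x) = frechet_derivative f (at x)" if "x \<in> U" for x
    using frechet_derivative_at[OF d[OF that]] by simp
  have "Ck_on k U (\<lambda>x. frechet_derivative g (at x) v)" for v
    by (rule Suc.IH[of "\<lambda>x. frechet_derivative f (at x) v"]) (use e Suc.prems(2) in auto)
  moreover have "g differentiable at x" if "x \<in> U" for x
    using d[OF that] by (rule differentiableI)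
  ultimately show ?case by simp
qed

text \<open>\<open>Ck_on\<close> speaks of the derivative selected by \<open>frechet_derivative\<close>; this rule allows any derivative
  to be supplied instead.\<close>

lemma Ck_on_SucI:
  assumes "open U" "\<And>x. x \<in> U \<Longrightarrow> (f has_derivative D x) (at x)"
    "\<And>v. Ck_on k U (\<lambda>x. D x v)"
  shows "Ck_on (Suc k) U f"
proof -
  have "frechet_derivative f (at x) = D x" if "x \<in> U" for x
    using frechet_derivative_at[OF assms(2)[OF that]] by simp
  then have "Ck_on k U (\<lambda>x. frechet_derivative f (at x) v)" for v
    by (intro Ck_on_cong[OF assms(1) _ assms(3)[of v]]) simp
  moreover have "f differentiable at x" if "x \<in> U" for x
    using assms(2)[OF that] by (rule differentiableI)
  ultimately show ?thesis by simp
qed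

lemma Ck_on_SucD:
  assumes "Ck_on (Suc k) U f"
  shows "\<And>x. x \<in> U \<Longrightarrow> (f has_derivative frechet_derivative f (at x)) (at x)"
    "\<And>v. Ck_on k U (\<lambda>x. frechet_derivative f (at x) v)"
  using assms by (auto simp flip: frechet_derivative_works)

lemma Ck_on_imp_continuous: "Ck_on k U f \<Longrightarrow> continuous_on U f"
proof (cases k)
  case (Suc j)
  assume "Ck_on k U f"
  then have "f differentiable_on U"
    unfolding Suc differentiable_on_def by (auto intro: differentiable_at_withinI)
  then show ?thesis by (rule differentiable_imp_continuous_on)
qed simp

lemma Ck_on_Suc_imp:
  assumes "Ck_on (Suc k) U f"
  shows "Ck_on k U f"
  using assms
proof (induction k arbitrary: f)
  case 0
  from Ck_on_imp_continuous[OF 0] show ?case by simp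
next
  case (Suc k)
  from Suc.prems have "f differentiable at x" if "x \<in> U" for x
    using that by simp
  moreover have "Ck_on k U (\<lambda>x. frechet_derivative f (at x) v)" for v
    by (rule Suc.IH[OF Ck_on_SucD(2)[OF Suc.prems]])
  ultimately show ?case by (subst Ck_on.simps) blast
qed

lemma Ck_on_const: "open U \<Longrightarrow> Ck_on k U (\<lambda>x. c)"
proof (induction k arbitrary: c)
  case 0
  then show ?case by simp
next
  case (Suc k)
  show ?case
    by (rule Ck_on_SucI[OF Suc.prems has_derivative_const Suc.IH[OF Suc.prems]])
qed

lemma Ck_on_bounded_linear:
  assumes "open U" "bounded_linear f"
  shows "Ck_on k U f"
proof (cases k)
  case 0
  then show ?thesis using assms by (simp add: linear_continuous_on)
next
  case (Suc j)
  show ?thesis unfolding Suc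
    by (rule Ck_on_SucI[OF assms(1) bounded_linear_imp_has_derivative[OF assms(2)]])
      (rule Ck_on_const[OF assms(1)])
qed

lemma Ck_on_add:
  assumes "open U" "Ck_on k U f" "Ck_on k U g"
  shows "Ck_on k U (\<lambda>x. f x + g x)"
  using assms(2,3)
proof (induction k arbitrary: f g)
  case 0
  then show ?case by (simp add: continuous_on_add)
next
  case (Suc k)
  note D = Ck_on_SucD[OF Suc.prems(1)] Ck_on_SucD[OF Suc.prems(2)]
  show ?case
    by (rule Ck_on_SucI[OF assms(1) has_derivative_add[OF D(1,3)] Suc.IH[OF D(2,4)]])
qed

lemma Ck_on_bilinear:
  assumes "open U" "bounded_bilinear h" "Ck_on k U f" "Ck_on k U g"
  shows "Ck_on k U (\<lambda>x. h (f x) (g x))"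
  using assms(3,4)
proof (induction k arbitrary: f g)
  case 0
  then show ?case by (simp add: bounded_bilinear.continuous_on[OF assms(2)])
next
  case (Suc k)
  note D = Ck_on_SucD[OF Suc.prems(1)] Ck_on_SucD[OF Suc.prems(2)]
  show ?case
    by (rule Ck_on_SucI[OF assms(1) bounded_bilinear.FDERIV[OF assms(2) D(1,3)]
          Ck_on_add[OF assms(1) Suc.IH[OF Ck_on_Suc_imp[OF Suc.prems(1)] D(4)]
            Suc.IH[OF D(2) Ck_on_Suc_imp[OF Suc.prems(2)]]]])
qed

lemma Ck_on_Suc_compose:
  fixes f :: "'a::euclidean_space \<Rightarrow> real"
  assumes "open U" "Ck_on (Suc k) U f" "Ck_on k U (\<lambda>x. \<phi>' (f x))"
    "\<And>x. x \<in> U \<Longrightarrow> (\<phi> has_real_derivative \<phi>' (f x)) (at (f x))"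
  shows "Ck_on (Suc k) U (\<lambda>x. \<phi> (f x))"
proof (rule Ck_on_SucI[OF assms(1)])
  note D = Ck_on_SucD[OF assms(2)]
  show "((\<lambda>x. \<phi> (f x)) has_derivative (\<lambda>v. frechet_derivative f (at x) v * \<phi>' (f x))) (at x)"
    if "x \<in> U" for x
    by (rule DERIV_compose_FDERIV[OF assms(4)[OF that] D(1)[OF that]])
  show "Ck_on k U (\<lambda>x. frechet_derivative f (at x) v * \<phi>' (f x))" for v
    by (rule Ck_on_bilinear[OF assms(1) bounded_bilinear_mult D(2) assms(3)])
qed

text \<open>Real powers form a family closed under differentiation, so one induction over \<open>k\<close> with the
  exponent generalized covers all of them; square root and logarithm follow.\<close>

lemma Ck_on_powr:
  fixes f :: "'a::euclidean_space \<Rightarrow> real"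
  assumes "open U" "Ck_on k U f" "\<And>x. x \<in> U \<Longrightarrow> f x > 0"
  shows "Ck_on k U (\<lambda>x. f x powr b)"
  using assms(2)
proof (induction k arbitrary: b)
  case 0
  then have "continuous_on U f" by simp
  moreover have "\<forall>x\<in>U. f x \<noteq> 0" using assms(3) by force
  ultimately have "continuous_on U (\<lambda>x. f x powr b)"
    by (intro continuous_on_powr continuous_on_const)
  then show ?case by simp
next
  case (Suc k)
  have "Ck_on k U (\<lambda>x. b * f x powr (b - 1))"
    by (rule Ck_on_bilinear[OF assms(1) bounded_bilinear_mult Ck_on_const[OF assms(1)]
        Suc.IH[OF Ck_on_Suc_imp[OF Suc.prems]]])
  then show ?case
    by (rule Ck_on_Suc_compose[where \<phi>' = "\<lambda>y. b * y powr (b - 1)" and \<phi> = "\<lambda>y. y powr b",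
          OF assms(1) Suc.prems])
      (simp add: has_real_derivative_powr assms(3))
qed

lemma Ck_on_sqrt:
  fixes f :: "'a::euclidean_space \<Rightarrow> real"
  assumes "open U" "Ck_on k U f" "\<And>x. x \<in> U \<Longrightarrow> f x > 0"
  shows "Ck_on k U (\<lambda>x. sqrt (f x))"
proof (rule Ck_on_cong[OF assms(1) _ Ck_on_powr[OF assms, of "1/2"]])
  show "f x powr (1/2) = sqrt (f x)" if "x \<in> U" for x
    using assms(3)[OF that] by (simp add: powr_half_sqrt)
qed

lemma Ck_on_ln:
  fixes f :: "'a::euclidean_space \<Rightarrow> real"
  assumes "open U" "Ck_on (Suc k) U f" "\<And>x. x \<in> U \<Longrightarrow> f x > 0"
  shows "Ck_on (Suc k) U (\<lambda>x. ln (f x))"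
proof (rule Ck_on_Suc_compose[where \<phi> = ln and \<phi>' = "\<lambda>y. y powr (-1)", OF assms(1,2)])
  show "Ck_on k U (\<lambda>x. f x powr (-1))"
    by (rule Ck_on_powr[OF assms(1) Ck_on_Suc_imp[OF assms(2)] assms(3)])
  show "(ln has_real_derivative f x powr (-1)) (at (f x))" if "x \<in> U" for x
    using DERIV_ln[OF assms(3)[OF that]] assms(3)[OF that] by (simp add: powr_minus)
qed

lemma Ck_on_exp:
  fixes f :: "'a::euclidean_space \<Rightarrow> real"
  assumes "open U" "Ck_on k U f"
  shows "Ck_on k U (\<lambda>x. exp (f x))"
  using assms(2)
proof (induction k)
  case 0
  then show ?case by (simp add: continuous_on_exp)
next
  case (Suc k)
  show ?case
    by (rule Ck_on_Suc_compose[where \<phi> = exp and \<phi>' = exp, OF assms(1) Suc.prems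
          Suc.IH[OF Ck_on_Suc_imp[OF Suc.prems]] DERIV_exp])
qed

lemma smooth_on_lincomb:
  assumes "smooth_on S f" "smooth_on S g"
  shows "smooth_on S (\<lambda>x. \<alpha> *\<^sub>R f x + \<beta> *\<^sub>R g x)"
  unfolding smooth_on_def
proof
  fix p assume "p \<in> S"
  obtain U f' where f': "open U" "p \<in> U" "\<And>k. Ck_on k U f'" "\<And>x. x \<in> S \<inter> U \<Longrightarrow> f x = f' x"
    using assms(1)[unfolded smooth_on_def, rule_format, OF \<open>p \<in> S\<close>] by blast
  obtain V g' where g': "open V" "p \<in> V" "\<And>k. Ck_on k V g'" "\<And>x. x \<in> S \<inter> V \<Longrightarrow> g x = g' x"
    using assms(2)[unfolded smooth_on_def, rule_format, OF \<open>p \<in> S\<close>] by blast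
  have o: "open (U \<inter> V)" using f' g' by blast
  have *: "Ck_on k (U \<inter> V) (\<lambda>x. c *\<^sub>R h x)" if "Ck_on k (U \<inter> V) h" for c k and h :: "'a \<Rightarrow> 'b"
    by (rule Ck_on_bilinear[OF o bounded_bilinear_scaleR Ck_on_const[OF o] that])
  have "Ck_on k (U \<inter> V) (\<lambda>x. \<alpha> *\<^sub>R f' x + \<beta> *\<^sub>R g' x)" for k
    by (intro Ck_on_add[OF o] * Ck_on_subset[OF f'(3)] Ck_on_subset[OF g'(3)] Int_lower1 Int_lower2)
  then show "\<exists>U h. open U \<and> p \<in> U \<and> (\<forall>k. Ck_on k U h) \<and>
      (\<forall>x\<in>S \<inter> U. \<alpha> *\<^sub>R f x + \<beta> *\<^sub>R g x = h x)"
    using o f'(2,4) g'(2,4)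
    by (intro exI[of _ "U \<inter> V"] exI[of _ "\<lambda>x. \<alpha> *\<^sub>R f' x + \<beta> *\<^sub>R g' x"]) simp
qed

lemma smooth_on_has_derivative:
  assumes "smooth_on S f" "p \<in> S"
  shows "(f has_derivative frechet_derivative f (at p within S)) (at p within S)"
proof -
  obtain U g where g: "open U" "p \<in> U" "\<And>k. Ck_on k U g" "\<And>x. x \<in> S \<inter> U \<Longrightarrow> f x = g x"
    using assms(1)[unfolded smooth_on_def, rule_format, OF assms(2)] by blast
  have "Ck_on (Suc 0) U g" by (rule g(3))
  then have "(g has_derivative frechet_derivative g (at p)) (at p within S)"
    by (rule has_derivative_at_withinI[OF Ck_on_SucD(1)[OF _ g(2)]])
  moreover obtain d where "d > 0" "ball p d \<subseteq> U"
    using g(1,2) by (meson open_contains_ball)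
  ultimately have "(f has_derivative frechet_derivative g (at p)) (at p within S)"
    using g(4) assms(2)
    by (intro has_derivative_transform_within[of g _ p S d f]) (auto simp: subset_iff dist_commute)
  then show ?thesis
    using differentiableI frechet_derivative_works by blast
qed


section \<open>Differentials of maps on the product of a sphere and a hyperbolic space\<close>

lemma mem_SH: "p \<in> SH \<longleftrightarrow> norm (fst p) = 1 \<and> snd p \<in> hyperbolic_space"
  by (cases p) (auto simp: SH_def)

lemma mem_tangent: "v \<in> tangent p \<longleftrightarrow> fst p \<bullet> fst v = 0 \<and> lorentz (snd p) (snd v) = 0"
  by (cases v) (auto simp: tangent_def)

lemma mem_tangent_sphere: "v \<in> tangent_sphere p \<longleftrightarrow> fst p \<bullet> fst v = 0 \<and> snd v = 0"
  by (cases v) (auto simp: tangent_sphere_def)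

lemma mem_tangent_hyp: "v \<in> tangent_hyp p \<longleftrightarrow> fst v = 0 \<and> lorentz (snd p) (snd v) = 0"
  by (cases v) (auto simp: tangent_hyp_def)

lemma tangent_sphere_subset: "tangent_sphere p \<subseteq> tangent p"
  by (auto simp: mem_tangent mem_tangent_sphere lorentz_bilinear)

lemma tangent_hyp_subset: "tangent_hyp p \<subseteq> tangent p"
  by (auto simp: mem_tangent mem_tangent_hyp)

lemma tangent_parts:
  assumes "v \<in> tangent p"
  shows "(fst v, 0) \<in> tangent_sphere p" "(0, snd v) \<in> tangent_hyp p"
    "(fst v, 0) \<in> tangent p" "(0, snd v) \<in> tangent p"
  using assms by (auto simp: mem_tangent mem_tangent_sphere mem_tangent_hyp lorentz_bilinear)

lemma subspace_tangent_hyp: "subspace (tangent_hyp p)"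
  by (auto simp: subspace_def mem_tangent_hyp lorentz_bilinear)

lemma subspace_tangent: "subspace (tangent p)"
  by (auto simp: subspace_def mem_tangent lorentz_bilinear inner_add_right)

lemma dim_tangent_factors:
  assumes "p \<in> (SH :: 'm::finite amb set)"
  shows "dim {u. fst p \<bullet> u = 0} = CARD('m)" "dim {v. lorentz (snd p) v = 0} = CARD('m)"
proof -
  have "fst p \<noteq> 0" using assms by (auto simp: mem_SH)
  then show "dim {u. fst p \<bullet> u = 0} = CARD('m)"
    by (subst dim_hyperplane) auto
  have "fst (snd p) > 0" using assms by (auto simp: mem_SH hyperbolic_space_def)
  then have "dim {v. (- fst (snd p), snd (snd p)) \<bullet> v = 0} = CARD('m)"
    by (subst dim_hyperplane) (auto simp: prod_eq_iff)
  moreover have "{v. lorentz (snd p) v = 0} = {v. (- fst (snd p), snd (snd p)) \<bullet> v = 0}"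
    by (auto simp: lorentz_def inner_prod_def)
  ultimately show "dim {v. lorentz (snd p) v = 0} = CARD('m)"
    by simp
qed

lemma dim_tangent:
  assumes "p \<in> (SH :: 'm::finite amb set)"
  shows "dim (tangent_sphere p) = CARD('m)" "dim (tangent_hyp p) = CARD('m)"
    "dim (tangent p) = 2 * CARD('m)"
proof -
  have 1: "subspace {u. fst p \<bullet> u = 0}" by (rule subspace_hyperplane)
  have 2: "subspace {v. lorentz (snd p) v = 0}"
    by (auto simp: subspace_def lorentz_bilinear)
  show "dim (tangent_sphere p) = CARD('m)"
    unfolding tangent_sphere_def
    using dim_Times[OF 1 subspace_single_0] dim_tangent_factors[OF assms] by simp
  show "dim (tangent_hyp p) = CARD('m)"
    unfolding tangent_hyp_def
    using dim_Times[OF subspace_single_0 2] dim_tangent_factors[OF assms] by simp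
  show "dim (tangent p) = 2 * CARD('m)"
    unfolding tangent_def
    using dim_Times[OF 1 2] dim_tangent_factors[OF assms] by simp
qed

lemma tangent_factors_nontrivial:
  assumes "p \<in> (SH :: 'm::finite amb set)"
  shows "\<exists>v\<in>tangent_sphere p. v \<noteq> 0" "\<exists>v\<in>tangent_hyp p. v \<noteq> 0"
proof -
  have "CARD('m) > 0" by simp
  then have "\<not> tangent_sphere p \<subseteq> {0}" "\<not> tangent_hyp p \<subseteq> {0}"
    using dim_tangent[OF assms] by (metis dim_eq_0 less_irrefl)+
  then show "\<exists>v\<in>tangent_sphere p. v \<noteq> 0" "\<exists>v\<in>tangent_hyp p. v \<noteq> 0" by auto
qed

text \<open>Curves in the product through \<open>p\<close> which move in one factor only, along a great circle and along
  a hyperbolic geodesic. Their velocities span the tangent space, and this is the only reason why a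
  derivative within \<open>SH\<close> is determined there.\<close>

definition sphere_curve :: "'m::finite amb \<Rightarrow> real \<times> (real ^ 'm) \<Rightarrow> real \<Rightarrow> 'm amb" where
  "sphere_curve p u \<tau> = (cos \<tau> *\<^sub>R fst p + sin \<tau> *\<^sub>R u, snd p)"

definition hyp_curve :: "'m::finite amb \<Rightarrow> real \<times> (real ^ 'm) \<Rightarrow> real \<Rightarrow> 'm amb" where
  "hyp_curve p w \<tau> = (fst p, cosh \<tau> *\<^sub>R snd p + sinh \<tau> *\<^sub>R w)"

lemma sphere_curve:
  assumes "p \<in> SH" "norm u = 1" "fst p \<bullet> u = 0"
  shows "sphere_curve p u \<tau> \<in> SH"
    and "(- sin \<tau> *\<^sub>R fst p + cos \<tau> *\<^sub>R u, 0) \<in> tangent_sphere (sphere_curve p u \<tau>)"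
    and "(sphere_curve p u has_vector_derivative (- sin \<tau> *\<^sub>R fst p + cos \<tau> *\<^sub>R u, 0)) (at \<tau>)"
proof -
  have n: "fst p \<bullet> fst p = 1" "u \<bullet> u = 1" "u \<bullet> fst p = 0"
    using assms by (auto simp: mem_SH dot_square_norm inner_commute)
  have "(norm (cos \<tau> *\<^sub>R fst p + sin \<tau> *\<^sub>R u))\<^sup>2 = 1"
    by (simp add: power2_norm_eq_inner inner_add_left inner_add_right n assms(3)
        flip: power2_eq_square)
  then have "norm (cos \<tau> *\<^sub>R fst p + sin \<tau> *\<^sub>R u) = 1"
    by (simp add: power2_eq_1_iff) (smt (verit) norm_ge_zero)
  then show "sphere_curve p u \<tau> \<in> SH"
    using assms(1) by (simp add: sphere_curve_def mem_SH)
  show "(- sin \<tau> *\<^sub>R fst p + cos \<tau> *\<^sub>R u, 0) \<in> tangent_sphere (sphere_curve p u \<tau>)"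
    by (simp add: mem_tangent_sphere sphere_curve_def inner_add_left inner_add_right
        inner_diff_right n assms(3))
  show "(sphere_curve p u has_vector_derivative (- sin \<tau> *\<^sub>R fst p + cos \<tau> *\<^sub>R u, 0)) (at \<tau>)"
    unfolding sphere_curve_def
    by (auto intro!: derivative_eq_intros has_vector_derivative_Pair)
qed

lemma hyp_curve:
  assumes "p \<in> SH" "lorentz w w = 1" "lorentz (snd p) w = 0"
  shows "hyp_curve p w \<tau> \<in> SH"
    and "(0, sinh \<tau> *\<^sub>R snd p + cosh \<tau> *\<^sub>R w) \<in> tangent_hyp (hyp_curve p w \<tau>)"
    and "(hyp_curve p w has_vector_derivative (0, sinh \<tau> *\<^sub>R snd p + cosh \<tau> *\<^sub>R w)) (at \<tau>)"
proof -
  have n: "lorentz (snd p) (snd p) = -1" "lorentz w (snd p) = 0"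
    using assms by (auto simp: mem_SH hyperbolic_space_def lorentz_commute)
  show "hyp_curve p w \<tau> \<in> SH"
    using assms hyperbolic_space_parallel[of "snd p" w \<tau>] n by (simp add: hyp_curve_def mem_SH)
  show "(0, sinh \<tau> *\<^sub>R snd p + cosh \<tau> *\<^sub>R w) \<in> tangent_hyp (hyp_curve p w \<tau>)"
    by (simp add: mem_tangent_hyp hyp_curve_def lorentz_bilinear n assms(2,3))
  show "(hyp_curve p w has_vector_derivative (0, sinh \<tau> *\<^sub>R snd p + cosh \<tau> *\<^sub>R w)) (at \<tau>)"
    unfolding hyp_curve_def
    by (auto intro!: derivative_eq_intros has_vector_derivative_Pair)
qed

lemma has_vector_derivative_along:
  assumes "(f has_derivative D) (at (\<gamma> t) within S)" "\<And>\<tau>. \<gamma> \<tau> \<in> S"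
    "(\<gamma> has_vector_derivative v) (at t)"
  shows "((\<lambda>\<tau>. f (\<gamma> \<tau>)) has_vector_derivative D v) (at t)"
proof -
  have "(f has_derivative D) (at (\<gamma> t) within range \<gamma>)"
    using assms(1,2) by (auto intro: has_derivative_subset)
  from has_derivative_in_compose[OF assms(3)[unfolded has_vector_derivative_def] this]
  have "((\<lambda>\<tau>. f (\<gamma> \<tau>)) has_derivative (\<lambda>x. D (x *\<^sub>R v))) (at t)" .
  then show ?thesis
    unfolding has_vector_derivative_def
    using has_derivative_linear[OF assms(1)] by (simp add: linear_cmul)
qed

text \<open>Both derivatives at a vector tangent to one factor are the velocity of \<open>f\<close> along a curve in that
  factor; linearity does the rest.\<close>

lemma has_derivative_within_SH_unique:
  fixes f :: "'m::finite amb \<Rightarrow> 'b::euclidean_space"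
  assumes "p \<in> SH" "v \<in> tangent p"
    and D: "(f has_derivative D) (at p within SH)" and D': "(f has_derivative D') (at p within SH)"
  shows "D v = D' v"
proof -
  interpret D: linear D by (rule has_derivative_linear[OF D])
  interpret D': linear D' by (rule has_derivative_linear[OF D'])
  have sphere: "D (u, 0) = D' (u, 0)" if "fst p \<bullet> u = 0" for u
  proof (cases "u = 0")
    case True
    then show ?thesis by (simp flip: zero_prod_def add: D.zero D'.zero)
  next
    case False
    let ?u = "(1 / norm u) *\<^sub>R u"
    have u: "norm ?u = 1" "fst p \<bullet> ?u = 0" using False that by auto
    have 0: "sphere_curve p ?u 0 = p" by (simp add: sphere_curve_def)
    have "((\<lambda>\<tau>. f (sphere_curve p ?u \<tau>)) has_vector_derivative A (?u, 0)) (at 0)"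
      if "(f has_derivative A) (at p within SH)" for A
      using has_vector_derivative_along[of f A "sphere_curve p ?u" 0 SH "(?u, 0)"]
        sphere_curve[OF assms(1) u] sphere_curve(3)[OF assms(1) u, of 0] that 0 by simp
    from vector_derivative_unique_at[OF this[OF D] this[OF D']]
    have "D (?u, 0) = D' (?u, 0)" .
    moreover have "(u, 0) = norm u *\<^sub>R (?u, 0 :: real \<times> (real ^ 'm))" using False by simp
    ultimately show ?thesis by (metis D.scaleR D'.scaleR)
  qed
  have hyp: "D (0, w) = D' (0, w)" if "lorentz (snd p) w = 0" for w
  proof (cases "w = 0")
    case True
    then show ?thesis by (simp flip: zero_prod_def add: D.zero D'.zero)
  next
    case False
    let ?c = "sqrt (lorentz w w)"
    let ?w = "(1 / ?c) *\<^sub>R w"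
    have pos: "lorentz w w > 0"
      using lorentz_orthogonal_spacelike[OF _ that False] assms(1) by (simp add: mem_SH)
    have u: "lorentz ?w ?w = 1" "lorentz (snd p) ?w = 0"
      using pos that by (auto simp: lorentz_bilinear)
    have 0: "hyp_curve p ?w 0 = p" by (simp add: hyp_curve_def)
    have "((\<lambda>\<tau>. f (hyp_curve p ?w \<tau>)) has_vector_derivative A (0, ?w)) (at 0)"
      if "(f has_derivative A) (at p within SH)" for A
      using has_vector_derivative_along[of f A "hyp_curve p ?w" 0 SH "(0, ?w)"]
        hyp_curve[OF assms(1) u] hyp_curve(3)[OF assms(1) u, of 0] that 0 by simp
    from vector_derivative_unique_at[OF this[OF D] this[OF D']]
    have "D (0, ?w) = D' (0, ?w)" .
    moreover have "(0, w) = ?c *\<^sub>R (0 :: real \<times> (real ^ 'm), ?w)" using pos by simp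
    ultimately show ?thesis by (metis D.scaleR D'.scaleR)
  qed
  have "v = (fst v, 0) + (0, snd v)" by simp
  then show ?thesis
    using sphere[of "fst v"] hyp[of "snd v"] assms(2)
    by (metis D.add D'.add mem_tangent)
qed

lemma differential_works:
  assumes "smooth_on SH f" "p \<in> SH"
  shows "(f has_derivative differential f p) (at p within SH)"
  unfolding differential_def by (rule smooth_on_has_derivative[OF assms])

lemma differential_eq:
  assumes "p \<in> SH" "v \<in> tangent p" "(f has_derivative D) (at p within SH)"
  shows "differential f p v = D v"
proof (rule has_derivative_within_SH_unique[OF assms(1,2) _ assms(3)])
  show "(f has_derivative differential f p) (at p within SH)"
    unfolding differential_def using assms(3) by (meson differentiableI frechet_derivative_works)
qed

lemma linear_differential:
  assumes "smooth_on SH f" "p \<in> SH"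
  shows "linear (differential f p)"
  by (rule has_derivative_linear[OF differential_works[OF assms]])

lemma differential_lincomb:
  assumes "smooth_on SH f" "smooth_on SH g" "p \<in> SH" "v \<in> tangent p"
  shows "differential (\<lambda>q. \<alpha> *\<^sub>R f q + \<beta> *\<^sub>R g q) p v
    = \<alpha> *\<^sub>R differential f p v + \<beta> *\<^sub>R differential g p v"
  by (rule differential_eq[OF assms(3,4)])
    (intro has_derivative_add has_derivative_scaleR_right differential_works assms)

text \<open>Differentiates relations such as \<open>\<langle>N, N\<rangle> = 1\<close> and \<open>\<langle>N, F\<rangle> = 0\<close>.\<close>

lemma lorentz_const_differential:
  assumes "smooth_on SH f" "smooth_on SH g" "p \<in> SH" "v \<in> tangent p"
    and "\<And>q. q \<in> SH \<Longrightarrow> lorentz (f q) (g q) = c"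
  shows "lorentz (f p) (differential g p v) + lorentz (differential f p v) (g p) = 0"
proof (rule has_derivative_within_SH_unique[OF assms(3,4)])
  show "((\<lambda>q. lorentz (f q) (g q)) has_derivative
      (\<lambda>v. lorentz (f p) (differential g p v) + lorentz (differential f p v) (g p))) (at p within SH)"
    by (intro bounded_bilinear.FDERIV[OF bounded_bilinear_lorentz] differential_works assms)
  show "((\<lambda>q. lorentz (f q) (g q)) has_derivative (\<lambda>v. 0)) (at p within SH)"
    by (rule has_derivative_transform[OF assms(3) _ has_derivative_const[of c]]) (simp add: assms(5))
qed

lemma lorentz_const_differential_right:
  assumes "smooth_on SH g" "p \<in> SH" "v \<in> tangent p"
    and "\<And>q. q \<in> SH \<Longrightarrow> lorentz z (g q) = c"
  shows "lorentz z (differential g p v) = 0"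
proof (rule has_derivative_within_SH_unique[OF assms(2,3)])
  show "((\<lambda>q. lorentz z (g q)) has_derivative (\<lambda>v. lorentz z (differential g p v))) (at p within SH)"
    by (intro bounded_linear.has_derivative[OF lorentz.bounded_linear_right] differential_works assms)
  show "((\<lambda>q. lorentz z (g q)) has_derivative (\<lambda>v. 0)) (at p within SH)"
    by (rule has_derivative_transform[OF assms(2) _ has_derivative_const[of c]]) (simp add: assms(4))
qed

lemma constant_if_zero_vector_derivative:
  fixes h :: "real \<Rightarrow> 'b::euclidean_space"
  assumes "\<And>t. (h has_vector_derivative 0) (at t)"
  shows "h s = h t"
proof -
  obtain c where "\<And>t. t \<in> UNIV \<Longrightarrow> h t = c"
    by (rule has_vector_derivative_zero_constant[of UNIV h]) (use assms in auto)
  then show ?thesis by simp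
qed

text \<open>A great circle joins any two points of the sphere. Antipodal points do not determine one, and
  there any unit tangent vector serves as its initial direction.\<close>

lemma constant_along_sphere:
  fixes f :: "'m::finite amb \<Rightarrow> 'b::euclidean_space"
  assumes "smooth_on SH f" "\<And>p v. p \<in> SH \<Longrightarrow> v \<in> tangent_sphere p \<Longrightarrow> differential f p v = 0"
    and "(x, y) \<in> SH" "(x', y) \<in> SH"
  shows "f (x, y) = f (x', y)"
proof -
  have step: "f (cos \<theta> *\<^sub>R x + sin \<theta> *\<^sub>R u, y) = f (x, y)"
    if xy: "(x, y) \<in> SH" and u: "norm u = 1" "x \<bullet> u = 0" for x u \<theta>
  proof -
    have u': "fst (x, y) \<bullet> u = 0" using u by simp
    note c = sphere_curve[OF xy u(1) u']
    have "((\<lambda>\<tau>. f (sphere_curve (x, y) u \<tau>)) has_vector_derivative 0) (at t)" for t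
      using has_vector_derivative_along[OF differential_works[OF assms(1) c(1)] c(1) c(3)]
        assms(2)[OF c(1) c(2)] by simp
    from constant_if_zero_vector_derivative[OF this, of \<theta> 0]
    show ?thesis by (simp add: sphere_curve_def)
  qed
  have n: "norm x = 1" "norm x' = 1" using assms by (auto simp: mem_SH)
  consider "x' = x" | "x' = - x" | "x' \<noteq> x" "x' \<noteq> - x" by blast
  then show ?thesis
  proof cases
    case 2
    obtain v where "v \<in> tangent_sphere (x, y)" "v \<noteq> 0"
      using tangent_factors_nontrivial(1)[OF assms(3)] by blast
    then have "fst v \<noteq> 0" "x \<bullet> fst v = 0" by (auto simp: mem_tangent_sphere prod_eq_iff)
    then show ?thesis
      using step[OF assms(3), of "(1 / norm (fst v)) *\<^sub>R fst v" pi] 2 by simp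
  next
    case 3
    from sphere_great_circle_to[OF n 3] step[OF assms(3)] show ?thesis by metis
  qed auto
qed

lemma constant_along_hyp:
  fixes f :: "'m::finite amb \<Rightarrow> 'b::euclidean_space"
  assumes "smooth_on SH f" "\<And>p v. p \<in> SH \<Longrightarrow> v \<in> tangent_hyp p \<Longrightarrow> differential f p v = 0"
    and "(x, y) \<in> SH" "(x, y') \<in> SH"
  shows "f (x, y) = f (x, y')"
proof (cases "y' = y")
  case False
  have h: "y \<in> hyperbolic_space" "y' \<in> hyperbolic_space" using assms by (auto simp: mem_SH)
  obtain w \<theta> where w: "lorentz w w = 1" "lorentz y w = 0" "y' = cosh \<theta> *\<^sub>R y + sinh \<theta> *\<^sub>R w"
    using hyperbolic_geodesic_to[OF h False] by blast
  have w': "lorentz (snd (x, y)) w = 0" using w by simp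
  note c = hyp_curve[OF assms(3) w(1) w']
  have "((\<lambda>\<tau>. f (hyp_curve (x, y) w \<tau>)) has_vector_derivative 0) (at t)" for t
    using has_vector_derivative_along[OF differential_works[OF assms(1) c(1)] c(1) c(3)]
      assms(2)[OF c(1) c(2)] by simp
  from constant_if_zero_vector_derivative[OF this, of 0 \<theta>]
  show ?thesis by (simp add: hyp_curve_def w(3))
qed simp

section \<open>Hypersurfaces\<close>

text \<open>Position, normal and tangent space together have as many independent directions as the ambient
  Lorentz space; independence follows from \<open>\<langle>F, F\<rangle> = -1\<close> and \<open>\<langle>N, N\<rangle> = 1\<close>.\<close>

lemma hypersurface_frame:
  fixes G M :: "'m::finite amb \<Rightarrow> real \<times> 'a::euclidean_space"
  assumes "hypersurface G" "unit_normal G M" "DIM('a) = 2 * CARD('m) + 1" and p: "p \<in> SH"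
  obtains \<alpha> \<beta> v where "v \<in> tangent p" "z = \<alpha> *\<^sub>R G p + \<beta> *\<^sub>R M p + differential G p v"
proof -
  let ?T = "differential G p ` tangent p"
  have sm: "smooth_on SH G" and inj: "inj_on (differential G p) (tangent p)"
    and sub: "G ` SH \<subseteq> hyperbolic_space"
    using assms p by (auto simp: hypersurface_def)
  have lin: "linear (differential G p)" by (rule linear_differential[OF sm p])
  have MM: "lorentz (M p) (M p) = 1" and MG: "lorentz (M p) (G p) = 0"
    and MT: "\<And>v. v \<in> tangent p \<Longrightarrow> lorentz (M p) (differential G p v) = 0"
    using assms p by (auto simp: unit_normal_def)
  have GG: "lorentz (G q) (G q) = -1" if "q \<in> SH" for q
    using sub that by (auto simp: hyperbolic_space_def)
  have GT: "lorentz (G p) (differential G p v) = 0" if "v \<in> tangent p" for v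
    using lorentz_const_differential[OF sm sm p that GG] by (simp add: lorentz_commute)
  have T: "subspace ?T" by (rule linear_subspace_image[OF lin subspace_tangent])
  have dT: "dim ?T = 2 * CARD('m)"
  proof -
    have "span (tangent p) = tangent p" using subspace_tangent by (rule span_eq_iff[THEN iffD2])
    then have "inj_on (differential G p) (span (tangent p))" using inj by metis
    from dim_image_eq[OF lin this] show ?thesis using dim_tangent(3)[OF p] by metis
  qed
  have M: "M p \<notin> span ?T"
    using MM MT T by (auto simp: span_eq_iff[THEN iffD2])
  have G: "G p \<notin> span (insert (M p) ?T)"
  proof
    assume "G p \<in> span (insert (M p) ?T)"
    then obtain k where "G p - k *\<^sub>R M p \<in> span ?T" unfolding span_breakdown_eq by blast
    then obtain v where v: "v \<in> tangent p" "G p - k *\<^sub>R M p = differential G p v"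
      using T by (auto simp: span_eq_iff[THEN iffD2])
    have "lorentz (G p) (G p - k *\<^sub>R M p) = 0" using GT v by simp
    then show False using GG[OF p] MG by (simp add: lorentz_bilinear lorentz_commute)
  qed
  have "dim (insert (G p) (insert (M p) ?T)) = DIM(real \<times> 'a)"
    using M G dT assms(3) by (simp add: dim_insert)
  then have "span (insert (G p) (insert (M p) ?T)) = UNIV"
    by (simp only: dim_eq_full)
  then have "z \<in> span (insert (G p) (insert (M p) ?T))" by simp
  then obtain \<alpha> \<beta> where "z - \<alpha> *\<^sub>R G p - \<beta> *\<^sub>R M p \<in> span ?T"
    unfolding span_breakdown_eq by blast
  then obtain v where "v \<in> tangent p" "z - \<alpha> *\<^sub>R G p - \<beta> *\<^sub>R M p = differential G p v"
    using T by (auto simp: span_eq_iff[THEN iffD2])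
  then show thesis by (intro that[of v \<alpha> \<beta>]) (auto simp: algebra_simps)
qed

lemma hypersurface_frame_orthogonal:
  fixes G M :: "'m::finite amb \<Rightarrow> real \<times> 'a::euclidean_space"
  assumes "hypersurface G" "unit_normal G M" "DIM('a) = 2 * CARD('m) + 1" "p \<in> SH"
    and "lorentz x (G p) = 0" "lorentz x (M p) = 0"
    and "\<And>v. v \<in> tangent p \<Longrightarrow> lorentz x (differential G p v) = 0"
  shows "x = 0"
proof (rule lorentz_nondegenerate)
  fix z
  from hypersurface_frame[OF assms(1-4), of z] show "lorentz x z = 0"
    by (metis (no_types, lifting) assms(5-7) lorentz.add_right lorentz.scaleR_right
        scaleR_zero_right add_0)
qed

text \<open>Reads off principal curvatures and principal spaces from the two fundamental forms when both are
  diagonal with respect to the splitting of the tangent space into its factors.\<close>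

lemma principal_curvatures_diagonal:
  fixes G M :: "'m::finite amb \<Rightarrow> real \<times> 'a::euclidean_space"
  assumes p: "p \<in> SH" and "A \<noteq> 0" "B \<noteq> 0" "\<kappa> \<noteq> \<eta>"
    and I: "\<And>v w. v \<in> tangent p \<Longrightarrow> w \<in> tangent p \<Longrightarrow>
      induced_metric G p v w = A * (fst v \<bullet> fst w) + B * lorentz (snd v) (snd w)"
    and II: "\<And>v w. v \<in> tangent p \<Longrightarrow> w \<in> tangent p \<Longrightarrow>
      second_fundamental_form G M p v w
        = \<kappa> * A * (fst v \<bullet> fst w) + \<eta> * B * lorentz (snd v) (snd w)"
  shows "principal_curvatures G M p = {\<kappa>, \<eta>}"
    and "principal_space G M p \<kappa> = tangent_sphere p" "principal_space G M p \<eta> = tangent_hyp p"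
    and "mean_curvature G M p = real CARD('m) * (\<kappa> + \<eta>)"
proof -
  have ps: "v \<in> principal_space G M p k \<longleftrightarrow>
      v \<in> tangent p \<and> (k = \<kappa> \<or> fst v = 0) \<and> (k = \<eta> \<or> snd v = 0)" for v k
  proof
    assume v: "v \<in> principal_space G M p k"
    then have t: "v \<in> tangent p" by (simp add: principal_space_def)
    have e: "second_fundamental_form G M p v w = k * induced_metric G p v w"
      if "w \<in> tangent p" for w
      using v that by (simp add: principal_space_def)
    have "k = \<kappa> \<or> fst v = 0"
      using e[OF tangent_parts(3)[OF t]] I[OF t tangent_parts(3)[OF t]]
        II[OF t tangent_parts(3)[OF t]] assms(2) by (auto simp: lorentz_bilinear)
    moreover have "k = \<eta> \<or> snd v = 0"
    proof -
      have "\<eta> * lorentz (snd v) (snd v) = k * lorentz (snd v) (snd v)"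
        using e[OF tangent_parts(4)[OF t]] I[OF t tangent_parts(4)[OF t]]
          II[OF t tangent_parts(4)[OF t]] assms(3) by (simp add: lorentz_bilinear)
      moreover have "lorentz (snd v) (snd v) > 0" if "snd v \<noteq> 0"
        using lorentz_orthogonal_spacelike[of "snd p", OF _ _ that] p t by (auto simp: mem_SH mem_tangent)
      ultimately show ?thesis by force
    qed
    ultimately show "v \<in> tangent p \<and> (k = \<kappa> \<or> fst v = 0) \<and> (k = \<eta> \<or> snd v = 0)"
      using t by blast
  next
    assume v: "v \<in> tangent p \<and> (k = \<kappa> \<or> fst v = 0) \<and> (k = \<eta> \<or> snd v = 0)"
    then show "v \<in> principal_space G M p k"
      using I II by (auto simp: principal_space_def algebra_simps lorentz_bilinear)
  qed
  show s: "principal_space G M p \<kappa> = tangent_sphere p"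
    using assms(4) by (auto simp: ps mem_tangent mem_tangent_sphere lorentz_bilinear)
  show h: "principal_space G M p \<eta> = tangent_hyp p"
    using assms(4) by (auto simp: ps mem_tangent mem_tangent_hyp)
  have other: "principal_space G M p k \<subseteq> {0}" if "k \<noteq> \<kappa>" "k \<noteq> \<eta>" for k
    using that by (auto simp: ps prod_eq_iff)
  show c: "principal_curvatures G M p = {\<kappa>, \<eta>}"
  proof
    show "principal_curvatures G M p \<subseteq> {\<kappa>, \<eta>}"
      using other by (auto simp: principal_curvatures_def)
    show "{\<kappa>, \<eta>} \<subseteq> principal_curvatures G M p"
      using tangent_factors_nontrivial[OF p] s h by (auto simp: principal_curvatures_def)
  qed
  show "mean_curvature G M p = real CARD('m) * (\<kappa> + \<eta>)"
    using assms(4) by (simp add: mean_curvature_def c s h dim_tangent[OF p] distrib_left)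
qed


section \<open>Parallel hypersurfaces of a cylinder\<close>

text \<open>The radii \<open>r\<close> and \<open>s\<close> of the factors, which \<open>cylinder\<close> only asserts to exist, are made
  parameters. The dimension condition says that the image is a hypersurface.\<close>

locale hyperbolic_cylinder =
  fixes F N :: "'m::finite amb \<Rightarrow> real \<times> 'a::euclidean_space" and k\<^sub>1 k\<^sub>2 r s :: real
  assumes cylinder: "cylinder F N k\<^sub>1 k\<^sub>2"
    and metric: "\<And>p v w. p \<in> SH \<Longrightarrow> v \<in> tangent p \<Longrightarrow> w \<in> tangent p \<Longrightarrow>
      induced_metric F p v w = product_metric r s v w"
    and r: "r > 0" and s: "s > 0"
    and k\<^sub>1: "k\<^sub>1 > 1" and k12: "k\<^sub>1 * k\<^sub>2 = 1"
    and dim: "DIM('a) = 2 * CARD('m) + 1"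
begin

lemma k\<^sub>2: "0 < k\<^sub>2" "k\<^sub>2 < 1"
proof -
  have "k\<^sub>2 = 1 / k\<^sub>1" using k\<^sub>1 k12 by (simp add: field_simps)
  then show "0 < k\<^sub>2" "k\<^sub>2 < 1" using k\<^sub>1 by auto
qed

lemma hypersurface: "hypersurface F" and normal: "unit_normal F N"
  using cylinder by (auto simp: cylinder_def)

lemma smooth: "smooth_on SH F" "smooth_on SH N"
  using hypersurface normal by (auto simp: hypersurface_def unit_normal_def)

lemma position_hyperbolic: "p \<in> SH \<Longrightarrow> F p \<in> hyperbolic_space"
  using hypersurface by (auto simp: hypersurface_def)

lemma frame_products:
  assumes "p \<in> SH"
  shows "lorentz (F p) (F p) = -1" "lorentz (N p) (N p) = 1"
    "lorentz (N p) (F p) = 0" "lorentz (F p) (N p) = 0"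
  using position_hyperbolic[OF assms] normal assms
  by (auto simp: hyperbolic_space_def unit_normal_def lorentz_commute[of "F p" "N p"])

lemma frame_products_tangent:
  assumes "p \<in> SH" "v \<in> tangent p"
  shows "lorentz (N p) (differential F p v) = 0" "lorentz (F p) (differential F p v) = 0"
    "lorentz (N p) (differential N p v) = 0" "lorentz (F p) (differential N p v) = 0"
proof -
  show 1: "lorentz (N p) (differential F p v) = 0"
    using normal assms by (auto simp: unit_normal_def)
  show "lorentz (F p) (differential F p v) = 0"
    using lorentz_const_differential[OF smooth(1) smooth(1) assms frame_products(1)]
    by (simp add: lorentz_commute)
  show "lorentz (N p) (differential N p v) = 0"
    using lorentz_const_differential[OF smooth(2) smooth(2) assms frame_products(2)]
    by (simp add: lorentz_commute)
  show "lorentz (F p) (differential N p v) = 0"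
    using lorentz_const_differential[OF smooth(2) smooth(1) assms frame_products(3)] 1
    by (simp add: lorentz_commute)
qed

lemma first_fundamental_form:
  assumes "p \<in> SH" "v \<in> tangent p" "w \<in> tangent p"
  shows "lorentz (differential F p v) (differential F p w)
    = r\<^sup>2 * (fst v \<bullet> fst w) + s\<^sup>2 * lorentz (snd v) (snd w)"
  using metric[OF assms] by (simp add: induced_metric_def product_metric_def)

text \<open>The principal space only constrains the tangential part of \<open>dN + k dF\<close>; its components along \<open>F\<close>
  and \<open>N\<close> vanish by the differentiated relations between \<open>F\<close> and \<open>N\<close>.\<close>

lemma weingarten:
  assumes "p \<in> SH" "v \<in> principal_space F N p k"
  shows "differential N p v = - k *\<^sub>R differential F p v"
proof -
  have v: "v \<in> tangent p" using assms(2) by (simp add: principal_space_def)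
  note o = frame_products_tangent[OF assms(1) v]
  have "differential N p v + k *\<^sub>R differential F p v = 0"
  proof (rule hypersurface_frame_orthogonal[OF hypersurface normal dim assms(1)])
    show "lorentz (differential N p v + k *\<^sub>R differential F p v) (F p) = 0"
      "lorentz (differential N p v + k *\<^sub>R differential F p v) (N p) = 0"
      using o by (simp_all add: lorentz_bilinear lorentz_commute)
    fix w assume "w \<in> tangent p"
    then have "second_fundamental_form F N p v w = k * induced_metric F p v w"
      using assms(2) by (simp add: principal_space_def)
    then show "lorentz (differential N p v + k *\<^sub>R differential F p v) (differential F p w) = 0"
      by (simp add: second_fundamental_form_def induced_metric_def lorentz_bilinear)
  qed
  then show ?thesis by (simp add: add_eq_0_iff)
qed

lemma differential_split:
  assumes "smooth_on SH f" "p \<in> SH"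
  shows "differential f p v = differential f p (fst v, 0) + differential f p (0, snd v)"
  by (simp flip: linear_add[OF linear_differential[OF assms]])

lemma differential_normal:
  assumes "p \<in> SH" "v \<in> tangent p"
  shows "differential N p v
    = - k\<^sub>1 *\<^sub>R differential F p (fst v, 0) - k\<^sub>2 *\<^sub>R differential F p (0, snd v)"
proof -
  have "principal_space F N p k\<^sub>1 = tangent_sphere p" "principal_space F N p k\<^sub>2 = tangent_hyp p"
    using cylinder assms(1) by (auto simp: cylinder_def)
  then have "differential N p (fst v, 0) = - k\<^sub>1 *\<^sub>R differential F p (fst v, 0)"
    "differential N p (0, snd v) = - k\<^sub>2 *\<^sub>R differential F p (0, snd v)"
    using tangent_parts[OF assms(2)] weingarten[OF assms(1), of "(fst v, 0)" k\<^sub>1]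
      weingarten[OF assms(1), of "(0, snd v)" k\<^sub>2] by blast+
  then show ?thesis
    using differential_split[OF smooth(2) assms(1), of v] by simp
qed

lemma differential_combination:
  assumes "p \<in> SH" "v \<in> tangent p"
  shows "differential (\<lambda>q. \<alpha> *\<^sub>R F q + \<beta> *\<^sub>R N q) p v
    = (\<alpha> - k\<^sub>1 * \<beta>) *\<^sub>R differential F p (fst v, 0) + (\<alpha> - k\<^sub>2 * \<beta>) *\<^sub>R differential F p (0, snd v)"
  using differential_lincomb[OF smooth assms, of \<alpha> \<beta>] differential_split[OF smooth(1) assms(1), of v]
    differential_normal[OF assms]
  by (simp add: algebra_simps)

definition parallel :: "real \<Rightarrow> 'm amb \<Rightarrow> real \<times> 'a" where
  "parallel \<sigma> p = cosh \<sigma> *\<^sub>R F p + sinh \<sigma> *\<^sub>R N p"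

definition parallel_normal :: "real \<Rightarrow> 'm amb \<Rightarrow> real \<times> 'a" where
  "parallel_normal \<sigma> p = sinh \<sigma> *\<^sub>R F p + cosh \<sigma> *\<^sub>R N p"

lemma parallel_smooth: "smooth_on SH (parallel \<sigma>)" "smooth_on SH (parallel_normal \<sigma>)"
  unfolding parallel_def[abs_def] parallel_normal_def[abs_def]
  by (intro smooth_on_lincomb smooth)+

lemma parallel_hyperbolic: "p \<in> SH \<Longrightarrow> parallel \<sigma> p \<in> hyperbolic_space"
  unfolding parallel_def
  by (intro hyperbolic_space_parallel position_hyperbolic frame_products)

lemma parallel_differential:
  assumes "p \<in> SH" "v \<in> tangent p"
  shows "differential (parallel \<sigma>) p v
      = (cosh \<sigma> - k\<^sub>1 * sinh \<sigma>) *\<^sub>R differential F p (fst v, 0)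
      + (cosh \<sigma> - k\<^sub>2 * sinh \<sigma>) *\<^sub>R differential F p (0, snd v)"
    and "differential (parallel_normal \<sigma>) p v
      = (sinh \<sigma> - k\<^sub>1 * cosh \<sigma>) *\<^sub>R differential F p (fst v, 0)
      + (sinh \<sigma> - k\<^sub>2 * cosh \<sigma>) *\<^sub>R differential F p (0, snd v)"
  unfolding parallel_def[abs_def] parallel_normal_def[abs_def]
  by (rule differential_combination[OF assms])+

lemma parallel_normal_products:
  assumes "p \<in> SH"
  shows "lorentz (parallel_normal \<sigma> p) (parallel_normal \<sigma> p) = 1"
    "lorentz (parallel_normal \<sigma> p) (parallel \<sigma> p) = 0"
    "v \<in> tangent p \<Longrightarrow> lorentz (parallel_normal \<sigma> p) (differential (parallel \<sigma>) p v) = 0"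
  using frame_products[OF assms] hyperbolic_pythagoras[of \<sigma>]
  by (simp_all add: parallel_normal_def parallel_def parallel_differential[OF assms] lorentz_bilinear
      frame_products_tangent[OF assms] tangent_parts power2_eq_square algebra_simps)

lemma parallel_form_split:
  assumes "p \<in> SH" "v \<in> tangent p" "w \<in> tangent p"
  shows "lorentz (\<alpha> *\<^sub>R differential F p (fst v, 0) + \<beta> *\<^sub>R differential F p (0, snd v))
      (\<gamma> *\<^sub>R differential F p (fst w, 0) + \<delta> *\<^sub>R differential F p (0, snd w))
    = \<alpha> * \<gamma> * r\<^sup>2 * (fst v \<bullet> fst w) + \<beta> * \<delta> * s\<^sup>2 * lorentz (snd v) (snd w)"
  using tangent_parts[OF assms(2)] tangent_parts[OF assms(3)]
  by (simp add: lorentz_bilinear first_fundamental_form[OF assms(1)])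

lemma parallel_forms:
  assumes "p \<in> SH" "v \<in> tangent p" "w \<in> tangent p"
  shows "induced_metric (parallel \<sigma>) p v w
      = (cosh \<sigma> - k\<^sub>1 * sinh \<sigma>)\<^sup>2 * r\<^sup>2 * (fst v \<bullet> fst w)
      + (cosh \<sigma> - k\<^sub>2 * sinh \<sigma>)\<^sup>2 * s\<^sup>2 * lorentz (snd v) (snd w)"
    and "second_fundamental_form (parallel \<sigma>) (parallel_normal \<sigma>) p v w
      = (k\<^sub>1 * cosh \<sigma> - sinh \<sigma>) * (cosh \<sigma> - k\<^sub>1 * sinh \<sigma>) * r\<^sup>2 * (fst v \<bullet> fst w)
      + (k\<^sub>2 * cosh \<sigma> - sinh \<sigma>) * (cosh \<sigma> - k\<^sub>2 * sinh \<sigma>) * s\<^sup>2 * lorentz (snd v) (snd w)"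
  by (simp_all add: induced_metric_def second_fundamental_form_def parallel_differential assms
      parallel_form_split[OF assms] power2_eq_square) (simp add: algebra_simps)

text \<open>The principal curvature at distance \<open>\<sigma>\<close> that evolves from the principal curvature \<open>k\<close>.\<close>

definition curvature :: "real \<Rightarrow> real \<Rightarrow> real" where
  "curvature k \<sigma> = (k * cosh \<sigma> - sinh \<sigma>) / (cosh \<sigma> - k * sinh \<sigma>)"

text \<open>As \<open>k\<^sub>2 < 1\<close>, the hyperbolic factor never degenerates, so that focal points arise from the
  spherical factor alone.\<close>

lemma hyp_factor_pos: "cosh \<sigma> - k\<^sub>2 * sinh \<sigma> > 0"
proof -
  have "k\<^sub>2 * sinh \<sigma> \<le> k\<^sub>2 * \<bar>sinh \<sigma>\<bar>" using k\<^sub>2 by (intro mult_left_mono) auto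
  also have "\<dots> \<le> 1 * \<bar>sinh \<sigma>\<bar>" using k\<^sub>2 by (intro mult_right_mono) auto
  also have "\<dots> < cosh \<sigma>"
    using sinh_less_cosh_real[of \<sigma>] sinh_less_cosh_real[of "- \<sigma>"] by (simp add: abs_if)
  finally show ?thesis by simp
qed

lemma nonfocal_factors:
  "(cosh \<sigma> - k\<^sub>1 * sinh \<sigma>) * (cosh \<sigma> - k\<^sub>2 * sinh \<sigma>)
    = cosh (2 * \<sigma>) - (k\<^sub>1 + k\<^sub>2) / 2 * sinh (2 * \<sigma>)"
proof -
  have "(cosh \<sigma> - k\<^sub>1 * sinh \<sigma>) * (cosh \<sigma> - k\<^sub>2 * sinh \<sigma>)
      = (cosh \<sigma>)\<^sup>2 - (k\<^sub>1 + k\<^sub>2) * (cosh \<sigma> * sinh \<sigma>) + (k\<^sub>1 * k\<^sub>2) * (sinh \<sigma>)\<^sup>2"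
    by (simp add: algebra_simps power2_eq_square)
  then show ?thesis unfolding k12 cosh_double sinh_double by (simp add: algebra_simps)
qed

context
  fixes \<sigma> :: real
  assumes nonfocal: "cosh \<sigma> - k\<^sub>1 * sinh \<sigma> \<noteq> 0"
begin

lemma curvature_neq: "curvature k\<^sub>1 \<sigma> \<noteq> curvature k\<^sub>2 \<sigma>"
proof
  assume "curvature k\<^sub>1 \<sigma> = curvature k\<^sub>2 \<sigma>"
  then have "(k\<^sub>1 * cosh \<sigma> - sinh \<sigma>) * (cosh \<sigma> - k\<^sub>2 * sinh \<sigma>)
      = (k\<^sub>2 * cosh \<sigma> - sinh \<sigma>) * (cosh \<sigma> - k\<^sub>1 * sinh \<sigma>)"
    using nonfocal hyp_factor_pos[of \<sigma>] by (simp add: curvature_def frac_eq_eq)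
  then have "(k\<^sub>1 - k\<^sub>2) * ((cosh \<sigma>)\<^sup>2 - (sinh \<sigma>)\<^sup>2) = 0"
    by (simp add: algebra_simps power2_eq_square)
  then show False using hyperbolic_pythagoras[of \<sigma>] k\<^sub>1 k\<^sub>2 by simp
qed

lemma curvature_product: "curvature k\<^sub>1 \<sigma> * curvature k\<^sub>2 \<sigma> = 1"
proof -
  have "(k\<^sub>1 * cosh \<sigma> - sinh \<sigma>) * (k\<^sub>2 * cosh \<sigma> - sinh \<sigma>)
      = (k\<^sub>1 * k\<^sub>2) * (cosh \<sigma>)\<^sup>2 - (k\<^sub>1 + k\<^sub>2) * (cosh \<sigma> * sinh \<sigma>) + (sinh \<sigma>)\<^sup>2"
    by (simp add: algebra_simps power2_eq_square)
  moreover have "(cosh \<sigma> - k\<^sub>1 * sinh \<sigma>) * (cosh \<sigma> - k\<^sub>2 * sinh \<sigma>)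
      = (cosh \<sigma>)\<^sup>2 - (k\<^sub>1 + k\<^sub>2) * (cosh \<sigma> * sinh \<sigma>) + (k\<^sub>1 * k\<^sub>2) * (sinh \<sigma>)\<^sup>2"
    by (simp add: algebra_simps power2_eq_square)
  moreover have "(cosh \<sigma> - k\<^sub>1 * sinh \<sigma>) * (cosh \<sigma> - k\<^sub>2 * sinh \<sigma>) \<noteq> 0"
    using nonfocal hyp_factor_pos[of \<sigma>] by simp
  ultimately show ?thesis by (simp only: curvature_def times_divide_times_eq k12) simp
qed

lemma curvature_sum:
  "curvature k\<^sub>1 \<sigma> + curvature k\<^sub>2 \<sigma>
    = 2 * ((k\<^sub>1 + k\<^sub>2) / 2 * cosh (2 * \<sigma>) - sinh (2 * \<sigma>))
      / (cosh (2 * \<sigma>) - (k\<^sub>1 + k\<^sub>2) / 2 * sinh (2 * \<sigma>))"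
proof -
  have "(k\<^sub>1 * cosh \<sigma> - sinh \<sigma>) * (cosh \<sigma> - k\<^sub>2 * sinh \<sigma>)
      + (k\<^sub>2 * cosh \<sigma> - sinh \<sigma>) * (cosh \<sigma> - k\<^sub>1 * sinh \<sigma>)
      = (k\<^sub>1 + k\<^sub>2) * ((cosh \<sigma>)\<^sup>2 + (sinh \<sigma>)\<^sup>2) - 2 * (k\<^sub>1 * k\<^sub>2 + 1) * (cosh \<sigma> * sinh \<sigma>)"
    by (simp add: algebra_simps power2_eq_square)
  also have "\<dots> = 2 * ((k\<^sub>1 + k\<^sub>2) / 2 * cosh (2 * \<sigma>) - sinh (2 * \<sigma>))"
    unfolding k12 cosh_double sinh_double by (simp add: field_simps)
  finally show ?thesis
    using nonfocal hyp_factor_pos[of \<sigma>]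
    by (simp add: curvature_def add_frac_eq nonfocal_factors)
qed

lemma parallel_hypersurface: "hypersurface (parallel \<sigma>)"
  unfolding hypersurface_def
proof (intro conjI ballI parallel_smooth)
  show "parallel \<sigma> ` SH \<subseteq> hyperbolic_space" using parallel_hyperbolic by auto
  fix p :: "'m amb" assume p: "p \<in> SH"
  have lin: "linear (differential (parallel \<sigma>) p)" by (rule linear_differential[OF parallel_smooth(1) p])
  show "inj_on (differential (parallel \<sigma>) p) (tangent p)"
    unfolding linear_inj_on_iff_eq_0[OF lin subspace_tangent]
  proof (intro ballI impI)
    fix v assume v: "v \<in> tangent p" "differential (parallel \<sigma>) p v = 0"
    have "induced_metric (parallel \<sigma>) p v w = 0" for w
      using v by (simp add: induced_metric_def lorentz_bilinear)
    then have 0: "(cosh \<sigma> - k\<^sub>1 * sinh \<sigma>)\<^sup>2 * r\<^sup>2 * (fst v \<bullet> fst w)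
      + (cosh \<sigma> - k\<^sub>2 * sinh \<sigma>)\<^sup>2 * s\<^sup>2 * lorentz (snd v) (snd w) = 0" if "w \<in> tangent p" for w
      using parallel_forms(1)[OF p v(1) that, of \<sigma>] by simp
    have "fst v = 0"
      using 0[OF tangent_parts(3)[OF v(1)]] nonfocal r by (simp add: lorentz_bilinear)
    moreover have "lorentz (snd v) (snd v) = 0"
      using 0[OF tangent_parts(4)[OF v(1)]] hyp_factor_pos[of \<sigma>] s by simp
    then have "snd v = 0"
      using lorentz_orthogonal_spacelike[of "snd p" "snd v"] p v(1)
      by (auto simp: mem_SH mem_tangent)
    ultimately show "v = 0" by (simp add: prod_eq_iff)
  qed
qed

lemma parallel_unit_normal: "unit_normal (parallel \<sigma>) (parallel_normal \<sigma>)"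
  by (auto simp: unit_normal_def parallel_smooth parallel_normal_products)

text \<open>A second unit normal differs from the first by a sign at every point. Its derivative has an
  additional normal component, but that does not contribute to the second fundamental form.\<close>

lemma any_unit_normal:
  fixes G M :: "'m amb \<Rightarrow> real \<times> 'a" and p :: "'m amb"
  assumes G: "hypersurface G" "\<And>p. p \<in> SH \<Longrightarrow> G p = parallel \<sigma> p" and M: "unit_normal G M"
    and p: "p \<in> SH"
  obtains \<epsilon> where "\<epsilon>\<^sup>2 = 1" "M p = \<epsilon> *\<^sub>R parallel_normal \<sigma> p"
    "principal_curvatures G M p = {\<epsilon> * curvature k\<^sub>1 \<sigma>, \<epsilon> * curvature k\<^sub>2 \<sigma>}"
    "principal_space G M p (\<epsilon> * curvature k\<^sub>1 \<sigma>) = tangent_sphere p"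
    "principal_space G M p (\<epsilon> * curvature k\<^sub>2 \<sigma>) = tangent_hyp p"
    "mean_curvature G M p
      = real CARD('m) * (\<epsilon> * (curvature k\<^sub>1 \<sigma> + curvature k\<^sub>2 \<sigma>))"
proof -
  have sm: "smooth_on SH G" "smooth_on SH M" using G(1) M by (auto simp: hypersurface_def unit_normal_def)
  have dG: "differential G q v = differential (parallel \<sigma>) q v" if "q \<in> SH" "v \<in> tangent q" for q v
  proof (rule differential_eq[OF that])
    show "(G has_derivative differential (parallel \<sigma>) q) (at q within SH)"
      by (rule has_derivative_transform[OF that(1) _ differential_works[OF parallel_smooth(1) that(1)]])
        (simp add: G(2))
  qed
  define \<epsilon> where "\<epsilon> q = lorentz (M q) (parallel_normal \<sigma> q)" for q
  have Mq: "M q = \<epsilon> q *\<^sub>R parallel_normal \<sigma> q" if q: "q \<in> SH" for q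
  proof -
    have "M q - \<epsilon> q *\<^sub>R parallel_normal \<sigma> q = 0"
    proof (rule hypersurface_frame_orthogonal[OF parallel_hypersurface parallel_unit_normal dim q])
      have MG: "lorentz (M q) (G q) = 0" "\<And>v. v \<in> tangent q \<Longrightarrow> lorentz (M q) (differential G q v) = 0"
        using M q by (auto simp: unit_normal_def)
      show "lorentz (M q - \<epsilon> q *\<^sub>R parallel_normal \<sigma> q) (parallel \<sigma> q) = 0"
        using MG(1) G(2)[OF q] by (simp add: lorentz_bilinear parallel_normal_products[OF q])
      show "lorentz (M q - \<epsilon> q *\<^sub>R parallel_normal \<sigma> q) (parallel_normal \<sigma> q) = 0"
        by (simp add: lorentz_bilinear parallel_normal_products[OF q] \<epsilon>_def)
      show "lorentz (M q - \<epsilon> q *\<^sub>R parallel_normal \<sigma> q) (differential (parallel \<sigma>) q v) = 0"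
        if "v \<in> tangent q" for v
        using MG(2)[OF that] dG[OF q that] that
        by (simp add: lorentz_bilinear parallel_normal_products[OF q])
    qed
    then show ?thesis by simp
  qed
  have "lorentz (M p) (M p) = 1" using M p by (auto simp: unit_normal_def)
  then have \<epsilon>2: "\<epsilon> p * \<epsilon> p = 1"
    unfolding Mq[OF p] by (simp add: lorentz_bilinear parallel_normal_products[OF p])
  define d\<epsilon> where "d\<epsilon> v = lorentz (M p) (differential (parallel_normal \<sigma>) p v)
      + lorentz (differential M p v) (parallel_normal \<sigma> p)" for v
  have d\<epsilon>: "(\<epsilon> has_derivative d\<epsilon>) (at p within SH)"
    unfolding \<epsilon>_def[abs_def] d\<epsilon>_def[abs_def]
    by (intro bounded_bilinear.FDERIV[OF bounded_bilinear_lorentz] differential_works sm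
        parallel_smooth p)
  have dM: "differential M p v = \<epsilon> p *\<^sub>R differential (parallel_normal \<sigma>) p v
      + d\<epsilon> v *\<^sub>R parallel_normal \<sigma> p" if "v \<in> tangent p" for v
  proof (rule differential_eq[OF p that])
    show "(M has_derivative (\<lambda>v. \<epsilon> p *\<^sub>R differential (parallel_normal \<sigma>) p v
        + d\<epsilon> v *\<^sub>R parallel_normal \<sigma> p)) (at p within SH)"
      by (rule has_derivative_transform[OF p _ has_derivative_scaleR[OF d\<epsilon>
            differential_works[OF parallel_smooth(2) p]]]) (simp add: Mq)
  qed
  let ?A = "(cosh \<sigma> - k\<^sub>1 * sinh \<sigma>)\<^sup>2 * r\<^sup>2" and ?B = "(cosh \<sigma> - k\<^sub>2 * sinh \<sigma>)\<^sup>2 * s\<^sup>2"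
  have I: "induced_metric G p v w = ?A * (fst v \<bullet> fst w) + ?B * lorentz (snd v) (snd w)"
    if "v \<in> tangent p" "w \<in> tangent p" for v w
    using parallel_forms(1)[OF p that, of \<sigma>] that by (simp add: induced_metric_def dG[OF p])
  have II: "second_fundamental_form G M p v w
      = \<epsilon> p * curvature k\<^sub>1 \<sigma> * ?A * (fst v \<bullet> fst w)
      + \<epsilon> p * curvature k\<^sub>2 \<sigma> * ?B * lorentz (snd v) (snd w)"
    if v: "v \<in> tangent p" and w: "w \<in> tangent p" for v w
  proof -
    have "second_fundamental_form G M p v w
        = \<epsilon> p * second_fundamental_form (parallel \<sigma>) (parallel_normal \<sigma>) p v w"
      by (simp add: second_fundamental_form_def dG[OF p w] dM[OF v] lorentz_bilinear
          parallel_normal_products[OF p] w)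
    then show ?thesis
      using nonfocal hyp_factor_pos[of \<sigma>]
      by (simp add: parallel_forms(2)[OF p v w] curvature_def power2_eq_square distrib_left)
  qed
  have AB: "?A \<noteq> 0" "?B \<noteq> 0" using nonfocal hyp_factor_pos[of \<sigma>] r s by auto
  have ne: "\<epsilon> p * curvature k\<^sub>1 \<sigma> \<noteq> \<epsilon> p * curvature k\<^sub>2 \<sigma>" using curvature_neq \<epsilon>2 by auto
  note D = principal_curvatures_diagonal[OF p AB ne I II]
  show thesis
    by (rule that[of "\<epsilon> p"])
      (use \<epsilon>2 Mq[OF p] D in \<open>simp_all add: power2_eq_square distrib_left\<close>)
qed

lemma parallel_curvatures:
  assumes "p \<in> SH"
  shows "principal_curvatures (parallel \<sigma>) (parallel_normal \<sigma>) p = {curvature k\<^sub>1 \<sigma>, curvature k\<^sub>2 \<sigma>}"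
    "principal_space (parallel \<sigma>) (parallel_normal \<sigma>) p (curvature k\<^sub>1 \<sigma>) = tangent_sphere p"
    "principal_space (parallel \<sigma>) (parallel_normal \<sigma>) p (curvature k\<^sub>2 \<sigma>) = tangent_hyp p"
    "mean_curvature (parallel \<sigma>) (parallel_normal \<sigma>) p
      = real CARD('m) * (curvature k\<^sub>1 \<sigma> + curvature k\<^sub>2 \<sigma>)"
proof -
  obtain \<epsilon> where \<epsilon>: "\<epsilon>\<^sup>2 = 1" "parallel_normal \<sigma> p = \<epsilon> *\<^sub>R parallel_normal \<sigma> p"
    "principal_curvatures (parallel \<sigma>) (parallel_normal \<sigma>) p = {\<epsilon> * curvature k\<^sub>1 \<sigma>, \<epsilon> * curvature k\<^sub>2 \<sigma>}"
    "principal_space (parallel \<sigma>) (parallel_normal \<sigma>) p (\<epsilon> * curvature k\<^sub>1 \<sigma>) = tangent_sphere p"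
    "principal_space (parallel \<sigma>) (parallel_normal \<sigma>) p (\<epsilon> * curvature k\<^sub>2 \<sigma>) = tangent_hyp p"
    "mean_curvature (parallel \<sigma>) (parallel_normal \<sigma>) p
      = real CARD('m) * (\<epsilon> * (curvature k\<^sub>1 \<sigma> + curvature k\<^sub>2 \<sigma>))"
    using any_unit_normal[OF parallel_hypersurface refl parallel_unit_normal assms] by blast
  have "lorentz (parallel_normal \<sigma> p) (parallel_normal \<sigma> p)
      = \<epsilon> * lorentz (parallel_normal \<sigma> p) (parallel_normal \<sigma> p)"
    by (subst \<epsilon>(2)) (simp add: lorentz_bilinear)
  then have "\<epsilon> = 1" by (simp add: parallel_normal_products[OF assms])
  with \<epsilon> show "principal_curvatures (parallel \<sigma>) (parallel_normal \<sigma>) p = {curvature k\<^sub>1 \<sigma>, curvature k\<^sub>2 \<sigma>}"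
    "principal_space (parallel \<sigma>) (parallel_normal \<sigma>) p (curvature k\<^sub>1 \<sigma>) = tangent_sphere p"
    "principal_space (parallel \<sigma>) (parallel_normal \<sigma>) p (curvature k\<^sub>2 \<sigma>) = tangent_hyp p"
    "mean_curvature (parallel \<sigma>) (parallel_normal \<sigma>) p
      = real CARD('m) * (curvature k\<^sub>1 \<sigma> + curvature k\<^sub>2 \<sigma>)"
    by simp_all
qed

lemma parallel_cylinder:
  "cylinder (parallel \<sigma>) (parallel_normal \<sigma>) (curvature k\<^sub>1 \<sigma>) (curvature k\<^sub>2 \<sigma>)"
proof -
  let ?r = "\<bar>cosh \<sigma> - k\<^sub>1 * sinh \<sigma>\<bar> * r" and ?s = "\<bar>cosh \<sigma> - k\<^sub>2 * sinh \<sigma>\<bar> * s"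
  have "induced_metric (parallel \<sigma>) p v w = product_metric ?r ?s v w"
    if "p \<in> SH" "v \<in> tangent p" "w \<in> tangent p" for p v w
    by (simp add: parallel_forms[OF that] product_metric_def power_mult_distrib)
  moreover have "?r > 0" "?s > 0" using nonfocal hyp_factor_pos[of \<sigma>] r s by auto
  ultimately show ?thesis
    unfolding cylinder_def
    using parallel_hypersurface parallel_unit_normal curvature_neq parallel_curvatures dim_tangent
    by metis
qed

end

text \<open>At the focal distance the differential kills the vectors tangent to the sphere.\<close>

lemma nonfocal_of_hypersurface:
  fixes G :: "'m amb \<Rightarrow> real \<times> 'a" and p :: "'m amb"
  assumes "hypersurface G" "\<And>p. p \<in> SH \<Longrightarrow> G p = parallel \<sigma> p" "p \<in> SH"
  shows "cosh \<sigma> - k\<^sub>1 * sinh \<sigma> \<noteq> 0"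
proof
  assume 0: "cosh \<sigma> - k\<^sub>1 * sinh \<sigma> = 0"
  obtain v where v: "v \<in> tangent_sphere p" "v \<noteq> 0" using tangent_factors_nontrivial(1)[OF assms(3)] by blast
  then have vt: "v \<in> tangent p" using tangent_sphere_subset by blast
  have lin: "linear (differential G p)" "inj_on (differential G p) (tangent p)"
    using assms(1,3) by (simp_all add: hypersurface_def linear_differential)
  have "differential G p v = differential (parallel \<sigma>) p v"
  proof (rule differential_eq[OF assms(3) vt])
    show "(G has_derivative differential (parallel \<sigma>) p) (at p within SH)"
      by (rule has_derivative_transform[OF assms(3) _ differential_works[OF parallel_smooth(1) assms(3)]])
        (simp add: assms(2))
  qed
  also have "\<dots> = 0"
    using v 0 linear_0[OF linear_differential[OF smooth(1) assms(3)]]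
    by (simp add: parallel_differential[OF assms(3) vt] mem_tangent_sphere zero_prod_def)
  finally show False using v vt lin linear_inj_on_iff_eq_0[OF lin(1) subspace_tangent] by blast
qed

end


section \<open>Flattening of submanifolds of totally geodesic subspaces\<close>

text \<open>For \<open>u = x + \<langle>x, P\<rangle> P\<close>, the projection of \<open>x\<close> to the orthogonal complement of \<open>P\<close>, this is
  \<open>\<surd>(1 + \<langle>u, u\<rangle>)\<close>: hyperbolic space is the graph of it over that complement.\<close>

definition height :: "real \<times> 'a::euclidean_space \<Rightarrow> real \<times> 'a \<Rightarrow> real" where
  "height P x = sqrt (1 + (lorentz x x + (lorentz x P)\<^sup>2))"

context
  fixes P :: "real \<times> 'a::euclidean_space"
  assumes P: "P \<in> hyperbolic_space"
begin

lemma lorentz_square_point: "lorentz P P = -1"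
  using P by (simp add: hyperbolic_space_def)

lemma height_arg_nonneg: "lorentz x x + (lorentz x P)\<^sup>2 \<ge> 0"
proof -
  let ?u = "x + lorentz x P *\<^sub>R P"
  have "lorentz P ?u = 0" by (simp add: lorentz_bilinear lorentz_square_point lorentz_commute)
  from lorentz_orthogonal_nonneg[OF P this] show ?thesis
    by (simp add: lorentz_bilinear lorentz_square_point lorentz_commute[of P x] power2_eq_square algebra_simps)
qed

lemma height_translate: "height P (x + c *\<^sub>R P) = height P x"
proof -
  have "lorentz (x + c *\<^sub>R P) (x + c *\<^sub>R P) + (lorentz (x + c *\<^sub>R P) P)\<^sup>2
      = lorentz x x + (lorentz x P)\<^sup>2"
    by (simp add: lorentz_bilinear lorentz_square_point lorentz_commute[of P x] power2_eq_square algebra_simps)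
  then show ?thesis by (simp only: height_def)
qed

lemma height_pos: "height P x > 0"
  using height_arg_nonneg[of x] by (simp add: height_def)

lemma hyperbolic_iff_height: "x \<in> hyperbolic_space \<longleftrightarrow> lorentz x P = - height P x"
proof
  assume x: "x \<in> hyperbolic_space"
  then have "lorentz x P < 0" by (rule lorentz_hyperbolic_neg[OF _ P])
  with x show "lorentz x P = - height P x" by (simp add: height_def hyperbolic_space_def)
next
  assume h: "lorentz x P = - height P x"
  then have "(lorentz x P)\<^sup>2 = (height P x)\<^sup>2" by simp
  also have "\<dots> = 1 + (lorentz x x + (lorentz x P)\<^sup>2)"
    using height_arg_nonneg[of x] by (simp add: height_def)
  finally have "(lorentz x P)\<^sup>2 = 1 + (lorentz x x + (lorentz x P)\<^sup>2)" .
  then have "lorentz x x = -1" by simp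
  then show "x \<in> hyperbolic_space"
    using hyperbolic_space_sign[OF P, of x] h height_pos[of x] by (simp add: lorentz_commute)
qed

lemma Ck_on_height_shift: "Ck_on k UNIV (\<lambda>x. x + (c * height P x) *\<^sub>R P)"
proof -
  have id: "Ck_on k UNIV (\<lambda>x :: real \<times> 'a. x)"
    by (rule Ck_on_bounded_linear[OF open_UNIV bounded_linear_ident])
  have l: "Ck_on k UNIV (\<lambda>x. lorentz x P)"
    by (rule Ck_on_bounded_linear[OF open_UNIV lorentz.bounded_linear_left])
  have "Ck_on k UNIV (\<lambda>x. 1 + (lorentz x x + lorentz x P * lorentz x P))"
    by (intro Ck_on_add[OF open_UNIV] Ck_on_const[OF open_UNIV]
        Ck_on_bilinear[OF open_UNIV bounded_bilinear_lorentz id id]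
        Ck_on_bilinear[OF open_UNIV bounded_bilinear_mult l l])
  then have "Ck_on k UNIV (height P)"
    unfolding height_def[abs_def] power2_eq_square
    by (rule Ck_on_sqrt[OF open_UNIV]) (use height_arg_nonneg in \<open>simp add: power2_eq_square add_pos_nonneg\<close>)
  then show ?thesis
    by (intro Ck_on_add[OF open_UNIV id] Ck_on_const[OF open_UNIV]
        Ck_on_bilinear[OF open_UNIV bounded_bilinear_scaleR]
        Ck_on_bilinear[OF open_UNIV bounded_bilinear_mult])
qed

end

text \<open>Shifting by \<open>- height P x\<close> in the direction of \<open>P\<close> is a diffeomorphism of Lorentz space which flattens
  hyperbolic space to the orthogonal complement of \<open>P\<close>. It preserves every subspace that contains
  \<open>P\<close> and so flattens totally geodesic subspaces through \<open>P\<close> as well.\<close>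

lemma submanifold_totally_geodesic:
  fixes S :: "(real \<times> 'a::euclidean_space) set"
  assumes "S \<subseteq> hyperbolic_space"
    and loc: "\<And>P. P \<in> S \<Longrightarrow> \<exists>W U. subspace W \<and> open U \<and> P \<in> U \<and> S \<inter> U = W \<inter> hyperbolic_space \<inter> U
      \<and> dim {z \<in> W. lorentz z P = 0} = d"
  shows "submanifold d S"
  unfolding submanifold_def
proof
  fix P assume "P \<in> S"
  then have P: "P \<in> hyperbolic_space" using assms(1) by blast
  obtain W U where W: "subspace W" and U: "open U" "P \<in> U" "S \<inter> U = W \<inter> hyperbolic_space \<inter> U"
    and d: "dim {z \<in> W. lorentz z P = 0} = d" using loc[OF \<open>P \<in> S\<close>] by blast
  have PW: "P \<in> W" using U \<open>P \<in> S\<close> by blast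
  define \<phi> where "\<phi> x = x + (- 1 * height P x) *\<^sub>R P" for x
  define \<psi> where "\<psi> x = x + (1 * height P x) *\<^sub>R P" for x
  have \<psi>\<phi>: "\<psi> (\<phi> x) = x" and \<phi>\<psi>: "\<phi> (\<psi> x) = x" for x
    unfolding \<phi>_def \<psi>_def height_translate[OF P] by simp_all
  have cont: "continuous_on UNIV \<phi>" "continuous_on UNIV \<psi>"
    unfolding \<phi>_def[abs_def] \<psi>_def[abs_def]
    by (rule Ck_on_imp_continuous[OF Ck_on_height_shift[OF P, where k = 0]])+
  have V: "\<phi> ` U = \<psi> -` U"
  proof
    show "\<psi> -` U \<subseteq> \<phi> ` U"
    proof
      fix y assume "y \<in> \<psi> -` U"
      then have "\<phi> (\<psi> y) \<in> \<phi> ` U" by blast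
      then show "y \<in> \<phi> ` U" by (simp only: \<phi>\<psi>)
    qed
  qed (auto simp: \<psi>\<phi>)
  let ?W = "{z \<in> W. lorentz z P = 0}"
  have image: "\<phi> x \<in> ?W \<longleftrightarrow> x \<in> W \<inter> hyperbolic_space" for x
  proof -
    have "\<phi> x \<in> W \<longleftrightarrow> x \<in> W"
    proof
      assume "\<phi> x \<in> W"
      then have "\<phi> x + (1 * height P x) *\<^sub>R P \<in> W"
        by (intro subspace_add[OF W] subspace_scale[OF W] PW)
      then show "x \<in> W" by (simp add: \<phi>_def)
    next
      assume "x \<in> W"
      then show "\<phi> x \<in> W"
        unfolding \<phi>_def by (intro subspace_add[OF W] subspace_scale[OF W] PW)
    qed
    moreover have "lorentz (\<phi> x) P = 0 \<longleftrightarrow> x \<in> hyperbolic_space"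
      unfolding hyperbolic_iff_height[OF P] \<phi>_def by (auto simp: lorentz_bilinear lorentz_square_point[OF P])
    ultimately show ?thesis by blast
  qed
  show "\<exists>U V (\<phi> :: real \<times> 'a \<Rightarrow> real \<times> 'a) \<psi> W. open U \<and> P \<in> U \<and> open V \<and> homeomorphism U V \<phi> \<psi> \<and>
      smooth_on U \<phi> \<and> smooth_on V \<psi> \<and> subspace W \<and> dim W = d \<and> \<phi> ` (S \<inter> U) = V \<inter> W"
  proof (intro exI conjI)
    show "open U" "P \<in> U" by (fact U)+
    show "open (\<phi> ` U)"
      unfolding V using cont(2) U(1) by (simp add: open_vimage continuous_on_eq_continuous_at)
    show "homeomorphism U (\<phi> ` U) \<phi> \<psi>"
      by (rule homeomorphismI) (auto simp: \<psi>\<phi> \<phi>\<psi> intro: continuous_on_subset[OF cont(1)]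
          continuous_on_subset[OF cont(2)])
    show "smooth_on U \<phi>" "smooth_on (\<phi> ` U) \<psi>"
      unfolding smooth_on_def \<phi>_def[abs_def] \<psi>_def[abs_def]
      using Ck_on_height_shift[OF P] open_UNIV by blast+
    show "subspace ?W" using W by (auto simp: subspace_def lorentz_bilinear)
    show "dim ?W = d" by (fact d)
    show "\<phi> ` (S \<inter> U) = \<phi> ` U \<inter> ?W"
      unfolding U(3) using image by blast
  qed
qed

section \<open>The focal submanifold\<close>

context hyperbolic_cylinder
begin

text \<open>Constant multiples of \<open>focal k\<^sub>1\<close> and \<open>focal k\<^sub>2\<close> parametrize the focal set in hyperbolic space and
  its spacelike counterpart; the combinations are chosen so that the differential of \<open>focal k\<^sub>i\<close>
  vanishes on one factor.\<close>

definition focal :: "real \<Rightarrow> 'm amb \<Rightarrow> real \<times> 'a" where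
  "focal k p = k *\<^sub>R F p + N p"

lemma focal_smooth: "smooth_on SH (focal k)"
  using smooth_on_lincomb[OF smooth, of k 1] by (simp add: focal_def[abs_def])

lemma focal_differential:
  assumes "p \<in> SH" "v \<in> tangent p"
  shows "differential (focal k) p v
    = (k - k\<^sub>1) *\<^sub>R differential F p (fst v, 0) + (k - k\<^sub>2) *\<^sub>R differential F p (0, snd v)"
  using differential_combination[OF assms, of k 1] by (simp add: focal_def[abs_def])

lemma differential_F_zero: "p \<in> SH \<Longrightarrow> differential F p (0, 0) = 0"
  using linear_0[OF linear_differential[OF smooth(1)]] by (simp add: zero_prod_def)

lemma focal_factor:
  assumes "(x, y) \<in> SH" "(x', y') \<in> SH"
  shows "focal k\<^sub>1 (x, y) = focal k\<^sub>1 (x', y)" "focal k\<^sub>2 (x, y) = focal k\<^sub>2 (x, y')"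
proof -
  have S: "(x', y) \<in> SH" "(x, y') \<in> SH" using assms by (auto simp: SH_def)
  show "focal k\<^sub>1 (x, y) = focal k\<^sub>1 (x', y)"
  proof (rule constant_along_sphere[OF focal_smooth _ assms(1) S(1)])
    fix p :: "'m amb" and v assume "p \<in> SH" "v \<in> tangent_sphere p"
    moreover from this have "v \<in> tangent p" using tangent_sphere_subset by blast
    ultimately show "differential (focal k\<^sub>1) p v = 0"
      by (simp add: focal_differential mem_tangent_sphere differential_F_zero)
  qed
  show "focal k\<^sub>2 (x, y) = focal k\<^sub>2 (x, y')"
  proof (rule constant_along_hyp[OF focal_smooth _ assms(1) S(2)])
    fix p :: "'m amb" and v assume "p \<in> SH" "v \<in> tangent_hyp p"
    moreover from this have "v \<in> tangent p" using tangent_hyp_subset by blast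
    ultimately show "differential (focal k\<^sub>2) p v = 0"
      by (simp add: focal_differential mem_tangent_hyp differential_F_zero)
  qed
qed

lemma focal_product:
  assumes "p \<in> SH"
  shows "lorentz (focal k p) (focal l p) = 1 - k * l"
  by (simp add: focal_def lorentz_bilinear frame_products[OF assms])

text \<open>At equal arguments this is \<open>1 - k\<^sub>1 k\<^sub>2 = 0\<close>. Because the first map sees only the hyperbolic and the
  second only the spherical coordinate, \<open>p\<close> and \<open>q\<close> can be merged into one argument.\<close>

lemma focal_orthogonal:
  assumes "p \<in> SH" "q \<in> SH"
  shows "lorentz (focal k\<^sub>1 p) (focal k\<^sub>2 q) = 0"
proof -
  obtain x y x' y' where e: "p = (x, y)" "q = (x', y')" by (cases p, cases q)
  have "(x', y) \<in> SH" using assms by (auto simp: SH_def e)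
  moreover have "focal k\<^sub>1 p = focal k\<^sub>1 (x', y)" "focal k\<^sub>2 q = focal k\<^sub>2 (x', y)"
    using focal_factor[of x y x' y'] focal_factor[of x' y' x y] assms unfolding e by simp_all
  ultimately show ?thesis using focal_product[of "(x', y)" k\<^sub>1 k\<^sub>2] k12 by simp
qed

lemma focal_span:
  assumes "p \<in> SH"
  obtains \<alpha> \<beta> v where "v \<in> tangent p"
    "z = \<alpha> *\<^sub>R focal k\<^sub>1 p + \<beta> *\<^sub>R focal k\<^sub>2 p + differential F p v"
proof -
  obtain a b v where v: "v \<in> tangent p" "z = a *\<^sub>R F p + b *\<^sub>R N p + differential F p v"
    using hypersurface_frame[OF hypersurface normal dim assms] by metis
  have ne: "k\<^sub>1 - k\<^sub>2 \<noteq> 0" using k\<^sub>1 k\<^sub>2 by simp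
  define \<alpha> where "\<alpha> = (a - k\<^sub>2 * b) / (k\<^sub>1 - k\<^sub>2)"
  define \<beta> where "\<beta> = b - \<alpha>"
  have "\<alpha> * (k\<^sub>1 - k\<^sub>2) = a - k\<^sub>2 * b" using ne by (simp add: \<alpha>_def)
  then have ab: "a = \<alpha> * k\<^sub>1 + \<beta> * k\<^sub>2" "b = \<alpha> + \<beta>"
    by (simp_all add: \<beta>_def algebra_simps)
  have "z = \<alpha> *\<^sub>R focal k\<^sub>1 p + \<beta> *\<^sub>R focal k\<^sub>2 p + differential F p v"
    unfolding v(2) ab focal_def by (simp add: algebra_simps)
  with v(1) show thesis by (rule that)
qed

lemma focal_products_tangent:
  assumes "p \<in> SH" "v \<in> tangent p"
  shows "lorentz (focal k p) (differential F p v) = 0"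
  by (simp add: focal_def lorentz_bilinear frame_products_tangent[OF assms])

lemma focal_nonzero_norm:
  assumes "p \<in> SH"
  shows "lorentz (focal k\<^sub>1 p) (focal k\<^sub>1 p) < 0" "lorentz (focal k\<^sub>2 p) (focal k\<^sub>2 p) > 0"
proof -
  have "1 * 1 < k\<^sub>1 * k\<^sub>1" using k\<^sub>1 by (intro mult_strict_mono) auto
  moreover have "k\<^sub>2 * k\<^sub>2 < 1 * 1" using k\<^sub>2 by (intro mult_strict_mono) auto
  ultimately show "lorentz (focal k\<^sub>1 p) (focal k\<^sub>1 p) < 0" "lorentz (focal k\<^sub>2 p) (focal k\<^sub>2 p) > 0"
    by (simp_all add: focal_product[OF assms])
qed

text \<open>The timelike subspace which cuts out the totally geodesic subspace that contains the focal set.\<close>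

definition focal_plane :: "(real \<times> 'a) set" where
  "focal_plane = {z. \<forall>q\<in>SH. lorentz z (focal k\<^sub>2 q) = 0}"

lemma subspace_focal_plane: "subspace focal_plane"
  by (auto simp: subspace_def focal_plane_def lorentz_bilinear)

lemma focal_in_plane: "p \<in> SH \<Longrightarrow> focal k\<^sub>1 p \<in> focal_plane"
  by (simp add: focal_plane_def focal_orthogonal)

text \<open>Identifies the tangent space of the totally geodesic subspace with the image of the hyperbolic
  directions, hence gives its dimension.\<close>

lemma focal_plane_tangent:
  assumes "p \<in> SH"
  shows "{z \<in> focal_plane. lorentz z (focal k\<^sub>1 p) = 0} = differential F p ` tangent_hyp p"
proof (intro equalityI subsetI)
  fix z assume z: "z \<in> {z \<in> focal_plane. lorentz z (focal k\<^sub>1 p) = 0}"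
  obtain \<alpha> \<beta> v where v: "v \<in> tangent p"
    and ze: "z = \<alpha> *\<^sub>R focal k\<^sub>1 p + \<beta> *\<^sub>R focal k\<^sub>2 p + differential F p v"
    using focal_span[OF assms] by metis
  have o: "lorentz (focal k\<^sub>1 p) (focal k\<^sub>2 p) = 0" "lorentz (focal k\<^sub>2 p) (focal k\<^sub>1 p) = 0"
    using focal_orthogonal[OF assms assms] by (simp_all add: lorentz_commute)
  have ot: "lorentz (differential F p v) (focal k p) = 0" for k
    using focal_products_tangent[OF assms v] by (simp add: lorentz_commute)
  have "lorentz z (focal k\<^sub>1 p) = 0" "lorentz z (focal k\<^sub>2 p) = 0"
    using z assms by (auto simp: focal_plane_def)
  then have 0: "\<alpha> = 0" "\<beta> = 0"
    using focal_nonzero_norm[OF assms] by (auto simp: ze lorentz_bilinear o ot)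
  have "lorentz z (differential (focal k\<^sub>2) p (fst v, 0)) = 0"
    using z by (intro lorentz_const_differential_right[OF focal_smooth assms tangent_parts(3)[OF v]])
      (auto simp: focal_plane_def)
  then have "lorentz z (differential F p (fst v, 0)) = 0"
    using k\<^sub>1 k\<^sub>2 by (simp add: focal_differential[OF assms tangent_parts(3)[OF v]]
        differential_F_zero[OF assms] lorentz_bilinear)
  then have "fst v = 0"
    using r by (simp add: ze 0 first_fundamental_form[OF assms v tangent_parts(3)[OF v]] lorentz_bilinear)
  then have "v \<in> tangent_hyp p" using v by (simp add: mem_tangent mem_tangent_hyp)
  then show "z \<in> differential F p ` tangent_hyp p" by (simp add: ze 0)
next
  fix z assume "z \<in> differential F p ` tangent_hyp p"
  then obtain v where v: "v \<in> tangent_hyp p" "z = differential F p v" by blast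
  then have vt: "v \<in> tangent p" using tangent_hyp_subset by blast
  have v0: "(0, snd v) = v" using v by (auto simp: mem_tangent_hyp prod_eq_iff)
  have "lorentz z (focal k\<^sub>2 q) = 0" if "q \<in> SH" for q
  proof -
    have "lorentz (focal k\<^sub>2 q) (differential (focal k\<^sub>1) p v) = 0"
      by (rule lorentz_const_differential_right[OF focal_smooth assms vt])
        (simp add: lorentz_commute[of "focal k\<^sub>2 q"] focal_orthogonal that)
    then have "lorentz (focal k\<^sub>2 q) z = 0"
      using k\<^sub>1 k\<^sub>2 by (simp add: focal_differential[OF assms vt] v0 v(2) lorentz_bilinear)
    then show ?thesis by (simp add: lorentz_commute)
  qed
  then show "z \<in> {z \<in> focal_plane. lorentz z (focal k\<^sub>1 p) = 0}"
    using focal_products_tangent[OF assms vt] v(2) by (simp add: focal_plane_def lorentz_commute)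
qed

lemma dim_focal_tangent:
  assumes "p \<in> SH"
  shows "dim (differential F p ` tangent_hyp p) = CARD('m)"
proof -
  have "inj_on (differential F p) (tangent p)"
    using hypersurface assms by (simp add: hypersurface_def)
  moreover have "span (tangent_hyp p) = tangent_hyp p"
    using subspace_tangent_hyp by (rule span_eq_iff[THEN iffD2])
  ultimately have "inj_on (differential F p) (span (tangent_hyp p))"
    using tangent_hyp_subset inj_on_subset by metis
  from dim_image_eq[OF linear_differential[OF smooth(1) assms] this] show ?thesis
    using dim_tangent(2)[OF assms] by metis
qed

lemma orthogonal_to_focal:
  fixes p :: "'m amb"
  assumes "\<And>q. q \<in> SH \<Longrightarrow> lorentz z (focal k\<^sub>1 q) = 0" "\<And>q. q \<in> SH \<Longrightarrow> lorentz z (focal k\<^sub>2 q) = 0"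
    and p: "p \<in> SH"
  shows "z = 0"
proof (rule lorentz_nondegenerate)
  fix w
  obtain \<alpha> \<beta> v where v: "v \<in> tangent p"
    and w: "w = \<alpha> *\<^sub>R focal k\<^sub>1 p + \<beta> *\<^sub>R focal k\<^sub>2 p + differential F p v"
    using focal_span[OF p] by metis
  have "lorentz z (differential (focal k\<^sub>1) p v) = 0" "lorentz z (differential (focal k\<^sub>2) p v) = 0"
    using assms by (auto intro!: lorentz_const_differential_right[OF focal_smooth p v])
  then have "lorentz z (differential F p (0, snd v)) = 0" "lorentz z (differential F p (fst v, 0)) = 0"
    using k\<^sub>1 k\<^sub>2 by (simp_all add: focal_differential[OF p v] lorentz_bilinear)
  then show "lorentz z w = 0"
    using assms p by (simp add: w lorentz_bilinear differential_split[OF smooth(1) p, of v])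
qed

text \<open>Extended by homogeneity from \<open>SH\<close> to the product of the punctured space and the future cone, the
  sum of the two focal maps becomes a map between spaces of equal dimension \<open>2 m + 2\<close>, to which an
  open mapping theorem applies.\<close>

definition cone_radius :: "'m amb \<Rightarrow> real" where
  "cone_radius z = sqrt (- lorentz (snd z) (snd z))"

definition cone_point :: "'m amb \<Rightarrow> 'm amb" where
  "cone_point z = ((1 / norm (fst z)) *\<^sub>R fst z, (1 / cone_radius z) *\<^sub>R snd z)"

definition cone_map :: "'m amb \<Rightarrow> real \<times> 'a" where
  "cone_map z = cone_radius z *\<^sub>R focal k\<^sub>1 (cone_point z) + norm (fst z) *\<^sub>R focal k\<^sub>2 (cone_point z)"

definition double_cone :: "'m amb set" where
  "double_cone = {z. norm (fst z) > 0 \<and> lorentz (snd z) (snd z) < 0 \<and> fst (snd z) > 0}"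

lemma open_double_cone: "open double_cone"
  unfolding double_cone_def lorentz_def
  by (intro open_Collect_conj open_Collect_less continuous_intros)

lemma cone_point_SH:
  assumes "z \<in> double_cone"
  shows "cone_point z \<in> SH"
proof -
  have "cone_radius z > 0" "(cone_radius z)\<^sup>2 = - lorentz (snd z) (snd z)"
    using assms by (auto simp: double_cone_def cone_radius_def)
  then show ?thesis
    using assms by (auto simp: mem_SH cone_point_def double_cone_def hyperbolic_space_def
        lorentz_bilinear field_simps power2_eq_square)
qed

text \<open>The derivative at \<open>p\<close> is onto: the two radial directions hit \<open>focal k\<^sub>1 p\<close> and \<open>focal k\<^sub>2 p\<close>, and the
  tangential directions hit, up to the factors \<open>k\<^sub>1 - k\<^sub>2\<close> and \<open>k\<^sub>2 - k\<^sub>1\<close>, the image of \<open>dF\<close>.\<close>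

lemma cone_map_open:
  assumes p: "p \<in> SH"
  shows "focal k\<^sub>1 p + focal k\<^sub>2 p \<in> interior (cone_map ` double_cone)"
proof -
  have pC: "p \<in> double_cone"
    using p by (auto simp: double_cone_def mem_SH hyperbolic_space_def)
  have n1: "norm (fst p) = 1" and pp: "lorentz (snd p) (snd p) = -1"
    using p by (auto simp: mem_SH hyperbolic_space_def)
  then have c1: "cone_radius p = 1" by (simp add: cone_radius_def)
  have cp: "cone_point p = p" by (simp add: cone_point_def c1 n1)
  define n' where "n' v = fst p \<bullet> fst v" for v :: "'m amb"
  define c' where "c' v = - lorentz (snd p) (snd v)" for v :: "'m amb"
  have dn: "((\<lambda>z. norm (fst z)) has_derivative n') (at p)"
  proof -
    have "fst p \<noteq> 0" using n1 by auto
    from has_derivative_compose[OF has_derivative_fst[OF has_derivative_ident] has_derivative_norm[OF this]]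
    show ?thesis unfolding n'_def[abs_def] by (simp add: sgn_div_norm n1 inner_commute)
  qed
  have dc: "(cone_radius has_derivative c') (at p)"
  proof -
    have 1: "((\<lambda>z. - lorentz (snd z) (snd z)) has_derivative
        (\<lambda>v. - (lorentz (snd p) (snd v) + lorentz (snd v) (snd p)))) (at p)"
      by (intro has_derivative_minus bounded_bilinear.FDERIV[OF bounded_bilinear_lorentz]
          has_derivative_snd has_derivative_ident)
    have "DERIV sqrt (- lorentz (snd p) (snd p)) :> 1/2"
      using DERIV_real_sqrt[of 1] by (simp add: pp)
    from DERIV_compose_FDERIV[OF this 1] show ?thesis
      unfolding cone_radius_def[abs_def] c'_def[abs_def] by (simp add: lorentz_commute)
  qed
  \<comment> \<open>Normalization by a function with value 1 at \<open>p\<close>, applied to both factors of \<open>cone_point\<close>.\<close>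
  have inv: "((\<lambda>z. (1 / \<nu> z) *\<^sub>R h z) has_derivative (\<lambda>v. h' v - \<nu>' v *\<^sub>R h p)) (at p)"
    if "(\<nu> has_derivative \<nu>') (at p)" "\<nu> p = 1" "(h has_derivative h') (at p)"
    for \<nu> :: "'m amb \<Rightarrow> real" and \<nu>' and h h' :: "'m amb \<Rightarrow> real \<times> (real ^ 'm)"
  proof -
    have "((\<lambda>z. 1 / \<nu> z) has_derivative (\<lambda>v. - \<nu>' v)) (at p)"
      using has_derivative_divide[OF has_derivative_const[of 1] that(1)] that(2) by simp
    from has_derivative_scaleR[OF this that(3)] show ?thesis
      by (simp add: that(2))
  qed
  \<comment> \<open>The differential of the retraction \<open>cone_point\<close> is the projection to the tangent space.\<close>
  define P' where "P' v = (fst v - n' v *\<^sub>R fst p, snd v - c' v *\<^sub>R snd p)" for v :: "'m amb"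
  have dP: "(cone_point has_derivative P') (at p)"
    unfolding cone_point_def[abs_def] P'_def[abs_def]
    by (intro has_derivative_Pair inv dn dc n1 c1 has_derivative_fst has_derivative_snd has_derivative_ident)
  have at: "at p within double_cone = at p" by (rule at_within_open[OF pC open_double_cone])
  have dG: "((\<lambda>z. focal k (cone_point z)) has_derivative (\<lambda>v. differential (focal k) p (P' v))) (at p)" for k
  proof -
    have "(focal k has_derivative differential (focal k) p) (at (cone_point p) within cone_point ` double_cone)"
      unfolding cp
      by (rule has_derivative_subset[OF differential_works[OF focal_smooth p]]) (use cone_point_SH in auto)
    from has_derivative_in_compose[OF dP[folded at] this] show ?thesis unfolding at .
  qed
  define D where "D v = (differential (focal k\<^sub>1) p (P' v) + c' v *\<^sub>R focal k\<^sub>1 p)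
      + (differential (focal k\<^sub>2) p (P' v) + n' v *\<^sub>R focal k\<^sub>2 p)" for v
  have dM: "(cone_map has_derivative D) (at p)"
    using has_derivative_add[OF has_derivative_scaleR[OF dc dG[of k\<^sub>1]] has_derivative_scaleR[OF dn dG[of k\<^sub>2]]]
    unfolding cone_map_def[abs_def] D_def[abs_def] cp c1 n1 by simp
  have lin: "linear D" by (rule has_derivative_linear[OF dM])
  have ne: "k\<^sub>1 - k\<^sub>2 \<noteq> 0" "k\<^sub>2 - k\<^sub>1 \<noteq> 0" using k\<^sub>1 k\<^sub>2 by auto
  have "surj D"
    unfolding surj_def
  proof
    fix z
    obtain \<alpha> \<beta> v where v: "v \<in> tangent p"
      and z: "z = \<alpha> *\<^sub>R focal k\<^sub>1 p + \<beta> *\<^sub>R focal k\<^sub>2 p + differential F p v"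
      using focal_span[OF p] by metis
    define u where "u = (\<beta> *\<^sub>R fst p + (1 / (k\<^sub>2 - k\<^sub>1)) *\<^sub>R fst v, \<alpha> *\<^sub>R snd p + (1 / (k\<^sub>1 - k\<^sub>2)) *\<^sub>R snd v)"
    let ?w = "((1 / (k\<^sub>2 - k\<^sub>1)) *\<^sub>R fst v, (1 / (k\<^sub>1 - k\<^sub>2)) *\<^sub>R snd v)"
    have nc: "n' u = \<beta>" "c' u = \<alpha>"
      using v n1 by (simp_all add: n'_def c'_def u_def lorentz_bilinear pp mem_tangent inner_add_right
          dot_square_norm)
    then have Pu: "P' u = ?w" by (simp add: P'_def u_def)
    have w: "?w \<in> tangent p" using v by (simp add: mem_tangent lorentz_bilinear)
    note L = linear_cmul[OF linear_differential[OF smooth(1) p]]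
    have "differential F p ((1 / (k\<^sub>2 - k\<^sub>1)) *\<^sub>R fst v, 0) = (1 / (k\<^sub>2 - k\<^sub>1)) *\<^sub>R differential F p (fst v, 0)"
      "differential F p (0, (1 / (k\<^sub>1 - k\<^sub>2)) *\<^sub>R snd v) = (1 / (k\<^sub>1 - k\<^sub>2)) *\<^sub>R differential F p (0, snd v)"
      using L[of _ "(fst v, 0)"] L[of _ "(0, snd v)"] by simp_all
    then have "D u = z"
      using ne by (simp add: D_def nc Pu focal_differential[OF p w] z
          differential_split[OF smooth(1) p, of v] differential_F_zero[OF p])
    then show "\<exists>u. z = D u" by blast
  qed
  then obtain g where g: "linear g" "D \<circ> g = id" using linear_surjective_right_inverse[OF lin] by blast
  have "cone_map p \<in> interior (cone_map ` double_cone)"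
  proof (rule sussmann_open_mapping[OF open_double_cone _ pC dM _ g(2) order_refl])
    show "bounded_linear g" using g(1) by (simp add: linear_conv_bounded_linear)
    show "p \<in> interior double_cone" using pC open_double_cone by (simp add: interior_open)
    have cr: "continuous_on double_cone cone_radius"
      unfolding cone_radius_def lorentz_def by (intro continuous_intros)
    have cpt: "continuous_on double_cone cone_point"
      unfolding cone_point_def
      by (intro continuous_intros cr) (auto simp: double_cone_def cone_radius_def)
    have "continuous_on SH (focal k)" for k
      by (rule differentiable_imp_continuous_on)
        (auto simp: differentiable_on_def intro: differentiableI smooth_on_has_derivative[OF focal_smooth])
    then have "continuous_on double_cone (\<lambda>z. focal k (cone_point z))" for k
      by (rule continuous_on_compose2[OF _ cpt]) (use cone_point_SH in auto)
    then show "continuous_on double_cone cone_map"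
      unfolding cone_map_def by (intro continuous_intros cr)
  qed
  then show ?thesis by (simp add: cone_map_def cp c1 n1)
qed

text \<open>A point \<open>Q\<close> of the plane near \<open>b focal k\<^sub>1 p\<close> is shifted by \<open>focal k\<^sub>2 p\<close>, away from the locus where
  the spherical part of \<open>cone_map\<close> collapses, to a value of \<open>cone_map\<close>. Comparing the components in
  the two orthogonal subspaces shows that \<open>Q\<close> is a multiple of a point of the focal image, and the
  normalization \<open>\<langle>Q, Q\<rangle> = -1\<close> fixes the multiple.\<close>

lemma focal_image_relatively_open:
  assumes p: "p \<in> SH" and b: "b > 0" "b\<^sup>2 * (k\<^sub>1\<^sup>2 - 1) = 1"
  obtains U where "open U" "b *\<^sub>R focal k\<^sub>1 p \<in> U"
    "focal_plane \<inter> hyperbolic_space \<inter> U \<subseteq> (\<lambda>q. b *\<^sub>R focal k\<^sub>1 q) ` SH"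
proof -
  define T where "T = interior (cone_map ` double_cone)"
  define h where "h Q = (1 / b) *\<^sub>R Q + focal k\<^sub>2 p" for Q
  show thesis
  proof (rule that[of "h -` T"])
    have "continuous_on UNIV h" unfolding h_def by (intro continuous_intros)
    then show "open (h -` T)"
      by (simp add: T_def open_vimage continuous_on_eq_continuous_at)
    show "b *\<^sub>R focal k\<^sub>1 p \<in> h -` T"
      using cone_map_open[OF p] b(1) by (simp add: h_def T_def)
    show "focal_plane \<inter> hyperbolic_space \<inter> h -` T \<subseteq> (\<lambda>q. b *\<^sub>R focal k\<^sub>1 q) ` SH"
    proof
      fix Q assume Q: "Q \<in> focal_plane \<inter> hyperbolic_space \<inter> h -` T"
      then have "h Q \<in> cone_map ` double_cone" using interior_subset by (auto simp: T_def)
      then obtain z where z: "z \<in> double_cone" "h Q = cone_map z" by blast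
      define q where "q = cone_point z"
      have q: "q \<in> SH" unfolding q_def by (rule cone_point_SH[OF z(1)])
      let ?\<rho> = "cone_radius z" and ?\<tau> = "norm (fst z)"
      have \<rho>: "?\<rho> > 0" using z(1) by (simp add: cone_radius_def double_cone_def)
      \<comment> \<open>The left side is orthogonal to all values of \<open>focal k\<^sub>2\<close>, the right side to all of \<open>focal k\<^sub>1\<close>.\<close>
      have e: "(1 / b) *\<^sub>R Q - ?\<rho> *\<^sub>R focal k\<^sub>1 q = ?\<tau> *\<^sub>R focal k\<^sub>2 q - focal k\<^sub>2 p"
        using z(2) by (simp add: h_def cone_map_def q_def algebra_simps)
      have "(1 / b) *\<^sub>R Q - ?\<rho> *\<^sub>R focal k\<^sub>1 q = 0"
      proof (rule orthogonal_to_focal[OF _ _ p])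
        fix x :: "'m amb" assume x: "x \<in> SH"
        show "lorentz ((1 / b) *\<^sub>R Q - ?\<rho> *\<^sub>R focal k\<^sub>1 q) (focal k\<^sub>2 x) = 0"
          using Q x focal_orthogonal[OF q x] by (simp add: lorentz_bilinear focal_plane_def)
        show "lorentz ((1 / b) *\<^sub>R Q - ?\<rho> *\<^sub>R focal k\<^sub>1 q) (focal k\<^sub>1 x) = 0"
          unfolding e using focal_orthogonal[OF x q] focal_orthogonal[OF x p]
          by (simp add: lorentz_bilinear lorentz_commute[of _ "focal k\<^sub>1 x"])
      qed
      then have "(1 / b) *\<^sub>R Q = ?\<rho> *\<^sub>R focal k\<^sub>1 q" by simp
      then have "b *\<^sub>R ((1 / b) *\<^sub>R Q) = b *\<^sub>R (?\<rho> *\<^sub>R focal k\<^sub>1 q)" by (simp only:)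
      then have Qe: "Q = (b * ?\<rho>) *\<^sub>R focal k\<^sub>1 q" using b(1) by simp
      have "lorentz Q Q = -1" using Q by (simp add: hyperbolic_space_def)
      then have "(b * ?\<rho>) * (b * ?\<rho>) * (1 - k\<^sub>1 * k\<^sub>1) = -1"
        unfolding Qe lorentz_bilinear focal_product[OF q] by (simp add: mult.assoc)
      then have "?\<rho>\<^sup>2 * (b\<^sup>2 * (k\<^sub>1\<^sup>2 - 1)) = 1"
        by (simp add: power2_eq_square algebra_simps)
      then have "?\<rho> = 1" using \<rho> b(2) by (simp add: power2_eq_1_iff)
      then show "Q \<in> (\<lambda>q. b *\<^sub>R focal k\<^sub>1 q) ` SH" using Qe q by (intro image_eqI[of _ _ q]) simp_all
    qed
  qed
qed

lemma parallel_focal: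
  assumes "cosh \<theta> = k\<^sub>1 * sinh \<theta>"
  shows "parallel \<theta> = (\<lambda>p. sinh \<theta> *\<^sub>R focal k\<^sub>1 p)"
  by (rule ext) (simp add: parallel_def focal_def assms scaleR_add_right mult.commute)

lemma focal_submanifold:
  assumes \<theta>: "cosh \<theta> = k\<^sub>1 * sinh \<theta>"
  shows "submanifold CARD('m) (parallel \<theta> ` SH)"
proof (rule submanifold_totally_geodesic)
  show S: "parallel \<theta> ` SH \<subseteq> hyperbolic_space" using parallel_hyperbolic by auto
  have "k\<^sub>1 * sinh \<theta> > 0" using \<theta> cosh_real_pos[of \<theta>] by simp
  then have b: "sinh \<theta> > 0" using k\<^sub>1 by (simp add: zero_less_mult_iff)
  have b2: "(sinh \<theta>)\<^sup>2 * (k\<^sub>1\<^sup>2 - 1) = 1"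
    using hyperbolic_pythagoras[of \<theta>] unfolding \<theta> by (simp add: power_mult_distrib algebra_simps)
  fix P assume "P \<in> parallel \<theta> ` SH"
  then obtain p where p: "p \<in> SH" "P = sinh \<theta> *\<^sub>R focal k\<^sub>1 p" by (auto simp: parallel_focal[OF \<theta>])
  obtain U where U: "open U" "sinh \<theta> *\<^sub>R focal k\<^sub>1 p \<in> U"
    "focal_plane \<inter> hyperbolic_space \<inter> U \<subseteq> (\<lambda>q. sinh \<theta> *\<^sub>R focal k\<^sub>1 q) ` SH"
    using focal_image_relatively_open[OF p(1) b b2] by blast
  show "\<exists>W U. subspace W \<and> open U \<and> P \<in> U \<and> parallel \<theta> ` SH \<inter> U = W \<inter> hyperbolic_space \<inter> U
      \<and> dim {z \<in> W. lorentz z P = 0} = CARD('m)"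
  proof (intro exI conjI)
    show "subspace focal_plane" by (rule subspace_focal_plane)
    show "open U" "P \<in> U" using U p by auto
    show "parallel \<theta> ` SH \<inter> U = focal_plane \<inter> hyperbolic_space \<inter> U"
    proof -
      have "(\<lambda>q. sinh \<theta> *\<^sub>R focal k\<^sub>1 q) ` SH \<subseteq> focal_plane"
        using subspace_scale[OF subspace_focal_plane focal_in_plane] by blast
      then show ?thesis using U(3) S unfolding parallel_focal[OF \<theta>] by blast
    qed
    have "{z \<in> focal_plane. lorentz z P = 0} = {z \<in> focal_plane. lorentz z (focal k\<^sub>1 p) = 0}"
      using b by (simp add: p(2) lorentz_bilinear)
    then show "dim {z \<in> focal_plane. lorentz z P = 0} = CARD('m)"
      by (simp add: focal_plane_tangent dim_focal_tangent p(1))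
  qed
qed

text \<open>The spherical directions are killed and the hyperbolic ones are scaled by a nonzero factor.\<close>

lemma focal_rank:
  assumes \<theta>: "cosh \<theta> = k\<^sub>1 * sinh \<theta>" and p: "p \<in> SH"
  shows "dim (differential (parallel \<theta>) p ` tangent p) = CARD('m)"
proof -
  let ?c = "cosh \<theta> - k\<^sub>2 * sinh \<theta>"
  have c: "?c \<noteq> 0" using hyp_factor_pos[of \<theta>] by simp
  have lin: "linear (differential F p)" by (rule linear_differential[OF smooth(1) p])
  have d: "differential (parallel \<theta>) p v = differential F p (0, ?c *\<^sub>R snd v)" if "v \<in> tangent p" for v
    using parallel_differential(1)[OF p that, of \<theta>] linear_cmul[OF lin, of ?c "(0, snd v)"] \<theta> by simp
  have "differential (parallel \<theta>) p ` tangent p = differential F p ` tangent_hyp p"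
  proof (intro equalityI subsetI)
    fix z assume "z \<in> differential (parallel \<theta>) p ` tangent p"
    then obtain v where "v \<in> tangent p" "z = differential F p (0, ?c *\<^sub>R snd v)" using d by auto
    moreover from this have "(0, ?c *\<^sub>R snd v) \<in> tangent_hyp p"
      by (simp add: mem_tangent mem_tangent_hyp lorentz_bilinear)
    ultimately show "z \<in> differential F p ` tangent_hyp p" by blast
  next
    fix z assume "z \<in> differential F p ` tangent_hyp p"
    then obtain v where v: "v \<in> tangent_hyp p" "z = differential F p v" by blast
    let ?v = "(0, (1 / ?c) *\<^sub>R snd v)"
    have "?v \<in> tangent p" using v(1) by (simp add: mem_tangent mem_tangent_hyp lorentz_bilinear)
    moreover have "(0, ?c *\<^sub>R snd ?v) = v" using v(1) c by (auto simp: mem_tangent_hyp prod_eq_iff)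
    ultimately show "z \<in> differential (parallel \<theta>) p ` tangent p" using d v(2) by (metis image_eqI)
  qed
  then show ?thesis by (simp add: dim_focal_tangent[OF p])
qed

end


section \<open>The distance function of the flow\<close>

definition flow_radicand :: "real \<Rightarrow> real \<Rightarrow> real \<Rightarrow> real" where
  "flow_radicand a m t = exp (2 * t / m) + a\<^sup>2 - 1"

text \<open>The logarithm makes smoothness and the limits accessible; the formulas for \<open>cosh\<close> and \<open>sinh\<close> of
  twice this function are consequences.\<close>

definition flow_distance :: "real \<Rightarrow> real \<Rightarrow> real \<Rightarrow> real" where
  "flow_distance a m t = ln ((sqrt (flow_radicand a m t) - exp (t / m)) / (a - 1)) / 2"

text \<open>The function equals \<open>((a + 1) e\<^sup>-\<^sup>x - (a - 1) e\<^sup>x) / 2\<close>, which is strictly decreasing.\<close>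

lemma cosh_sinh_eq_inj:
  fixes a x y :: real
  assumes a: "a > 1" and eq: "cosh x - a * sinh x = cosh y - a * sinh y"
  shows "x = y"
proof -
  have less: "cosh y - a * sinh y < cosh x - a * sinh x" if "x < y" for x y :: real
  proof -
    have "(a - 1) * exp x < (a - 1) * exp y" "(a + 1) * exp (- y) < (a + 1) * exp (- x)"
      using that a by auto
    moreover have "cosh z - a * sinh z = ((a + 1) * exp (- z) - (a - 1) * exp z) / 2" for z :: real
      by (simp add: cosh_def sinh_def field_simps)
    ultimately show ?thesis by (simp only:) (simp add: divide_strict_right_mono)
  qed
  show ?thesis using less[of x y] less[of y x] eq by (cases x y rule: linorder_cases) auto
qed

context
  fixes a m :: real
  assumes a: "a > 1" and m: "m > 0"
begin

lemma radicand_eq: "flow_radicand a m t = (exp (t / m))\<^sup>2 + (a\<^sup>2 - 1)"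
  by (simp add: flow_radicand_def flip: exp_double)

lemma square_minus_one_pos: "a\<^sup>2 - 1 > 0"
  using a by (simp add: one_less_power)

lemma radicand_pos: "flow_radicand a m t > 0"
  unfolding radicand_eq using square_minus_one_pos by (intro add_nonneg_pos) auto

lemma sqrt_radicand: "(sqrt (flow_radicand a m t))\<^sup>2 = (exp (t / m))\<^sup>2 + (a\<^sup>2 - 1)"
  using radicand_pos[of t] by (simp add: radicand_eq)

lemma exp_less_sqrt_radicand: "exp (t / m) < sqrt (flow_radicand a m t)"
  using square_minus_one_pos by (intro real_less_rsqrt) (simp add: radicand_eq)

lemma exp_flow_distance:
  "exp (2 * flow_distance a m t) = (sqrt (flow_radicand a m t) - exp (t / m)) / (a - 1)"
  "exp (- (2 * flow_distance a m t)) = (sqrt (flow_radicand a m t) + exp (t / m)) / (a + 1)"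
proof -
  let ?E = "exp (t / m)" and ?R = "sqrt (flow_radicand a m t)"
  have pos: "?R - ?E > 0" using exp_less_sqrt_radicand[of t] by simp
  show 1: "exp (2 * flow_distance a m t) = (?R - ?E) / (a - 1)"
    using pos a by (simp add: flow_distance_def)
  have "(?R - ?E) * (?R + ?E) = (a - 1) * (a + 1)"
    using sqrt_radicand[of t] by (simp add: algebra_simps power2_eq_square)
  then show "exp (- (2 * flow_distance a m t)) = (?R + ?E) / (a + 1)"
    unfolding exp_minus 1 using pos a by (simp add: field_simps)
qed

lemma cosh_flow_distance:
  "cosh (2 * flow_distance a m t) = (- exp (t / m) + a * sqrt (flow_radicand a m t)) / (a\<^sup>2 - 1)"
  and sinh_flow_distance:
  "sinh (2 * flow_distance a m t) = (- a * exp (t / m) + sqrt (flow_radicand a m t)) / (a\<^sup>2 - 1)"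
proof -
  have s: "a\<^sup>2 - 1 = (a - 1) * (a + 1)" by (simp add: algebra_simps power2_eq_square)
  show "cosh (2 * flow_distance a m t) = (- exp (t / m) + a * sqrt (flow_radicand a m t)) / (a\<^sup>2 - 1)"
    "sinh (2 * flow_distance a m t) = (- a * exp (t / m) + sqrt (flow_radicand a m t)) / (a\<^sup>2 - 1)"
    unfolding cosh_def sinh_def exp_flow_distance s using a
    by (simp_all add: divide_simps) (simp_all add: algebra_simps)
qed

text \<open>Denominator and numerator of \<open>H / (2 m)\<close> for the parallel hypersurface at this distance.\<close>

lemma flow_distance_products:
  "cosh (2 * flow_distance a m t) - a * sinh (2 * flow_distance a m t) = exp (t / m)"
  "a * cosh (2 * flow_distance a m t) - sinh (2 * flow_distance a m t) = sqrt (flow_radicand a m t)"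
  unfolding cosh_flow_distance sinh_flow_distance using square_minus_one_pos
  by (simp_all add: divide_simps) (simp_all add: algebra_simps power2_eq_square)

lemma flow_distance_zero: "flow_distance a m 0 = 0"
  using a by (simp add: flow_distance_def flow_radicand_def)

text \<open>The right-hand side is \<open>- 1 / H\<close>.\<close>

lemma flow_distance_derivative:
  "(flow_distance a m has_real_derivative - exp (t / m) / (2 * m * sqrt (flow_radicand a m t))) (at t)"
proof -
  let ?E = "exp (t / m)" and ?R = "sqrt (flow_radicand a m t)"
  have pos: "?R - ?E > 0" "?R > 0" using exp_less_sqrt_radicand[of t] radicand_pos[of t] by auto
  have dE: "((\<lambda>t. exp (t / m)) has_real_derivative ?E / m) (at t)"
    using m by (auto intro!: derivative_eq_intros)
  have "(flow_radicand a m has_real_derivative 2 * ?E\<^sup>2 / m) (at t)"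
    unfolding flow_radicand_def[abs_def] using m
    by (auto intro!: derivative_eq_intros simp flip: exp_double)
  from DERIV_chain2[OF DERIV_real_sqrt[OF radicand_pos[of t]] this]
  have dR: "((\<lambda>t. sqrt (flow_radicand a m t)) has_real_derivative ?E\<^sup>2 / (m * ?R)) (at t)"
    by (simp add: field_simps)
  have "((\<lambda>t. (sqrt (flow_radicand a m t) - exp (t / m)) / (a - 1)) has_real_derivative
      (?E\<^sup>2 / (m * ?R) - ?E / m) / (a - 1)) (at t)"
    by (intro DERIV_cdivide DERIV_diff dR dE)
  from DERIV_chain2[OF DERIV_ln this] pos a
  have "((\<lambda>t. ln ((sqrt (flow_radicand a m t) - exp (t / m)) / (a - 1))) has_real_derivative
      inverse ((?R - ?E) / (a - 1)) * ((?E\<^sup>2 / (m * ?R) - ?E / m) / (a - 1))) (at t)"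
    by simp
  from DERIV_cdivide[OF this, of 2]
  have "(flow_distance a m has_real_derivative
      inverse ((?R - ?E) / (a - 1)) * ((?E\<^sup>2 / (m * ?R) - ?E / m) / (a - 1)) / 2) (at t)"
    unfolding flow_distance_def[abs_def] .
  moreover have "inverse ((?R - ?E) / (a - 1)) * ((?E\<^sup>2 / (m * ?R) - ?E / m) / (a - 1)) / 2
      = - ?E / (2 * m * ?R)"
  proof -
    have "?E\<^sup>2 / (m * ?R) - ?E / m = - (?R - ?E) * (?E / (m * ?R))"
      using pos m by (simp add: field_simps power2_eq_square)
    moreover have "inverse (d / c) * (- d * x / c) / 2 = - (x / 2)" if "d \<noteq> 0" "c \<noteq> 0" for c d x :: real
      using that by (simp add: field_simps)
    from this[of "?R - ?E" "a - 1" "?E / (m * ?R)"]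
    have "inverse ((?R - ?E) / (a - 1)) * (- (?R - ?E) * (?E / (m * ?R)) / (a - 1)) / 2
        = - (?E / (m * ?R) / 2)" using pos a by simp
    ultimately show ?thesis by (simp only:) (simp add: mult_ac)
  qed
  ultimately show ?thesis by (rule DERIV_cong)
qed

lemma Ck_on_flow_distance: "Ck_on k UNIV (flow_distance a m)"
proof -
  have lin: "Ck_on j UNIV (\<lambda>t::real. c * t)" for c :: real and j
    by (rule Ck_on_bounded_linear[OF open_UNIV bounded_linear_mult_right])
  have cst: "Ck_on j UNIV (\<lambda>t::real. c)" for c :: real and j
    by (rule Ck_on_const[OF open_UNIV])
  have mul: "Ck_on j UNIV (\<lambda>t. c * f t)" if "Ck_on j UNIV f" for c :: real and f :: "real \<Rightarrow> real" and j
    by (rule Ck_on_bilinear[OF open_UNIV bounded_bilinear_mult cst that])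
  have q: "Ck_on j UNIV (\<lambda>t. exp (2 / m * t) + (a\<^sup>2 - 1))" for j
    by (intro Ck_on_add[OF open_UNIV] Ck_on_exp[OF open_UNIV] lin cst)
  have qp: "exp (2 / m * t) + (a\<^sup>2 - 1) > 0" for t
    using radicand_pos[of t] by (simp add: flow_radicand_def algebra_simps)
  have "Ck_on (Suc k) UNIV (\<lambda>t. sqrt (exp (2 / m * t) + (a\<^sup>2 - 1)) + (-1) * exp (1 / m * t))"
    by (intro Ck_on_add[OF open_UNIV] mul Ck_on_exp[OF open_UNIV] lin Ck_on_sqrt[OF open_UNIV q qp])
  then have "Ck_on (Suc k) UNIV
      (\<lambda>t. 1 / (a - 1) * (sqrt (exp (2 / m * t) + (a\<^sup>2 - 1)) + (-1) * exp (1 / m * t)))"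
    by (rule mul)
  then have "Ck_on (Suc k) UNIV
      (\<lambda>t. ln (1 / (a - 1) * (sqrt (exp (2 / m * t) + (a\<^sup>2 - 1)) + (-1) * exp (1 / m * t))))"
  proof (rule Ck_on_ln[OF open_UNIV])
    fix t
    have "sqrt (exp (2 / m * t) + (a\<^sup>2 - 1)) + (-1) * exp (1 / m * t) > 0"
      using exp_less_sqrt_radicand[of t] by (simp add: flow_radicand_def algebra_simps)
    then show "1 / (a - 1) * (sqrt (exp (2 / m * t) + (a\<^sup>2 - 1)) + (-1) * exp (1 / m * t)) > 0"
      using a by simp
  qed
  then have "Ck_on (Suc k) UNIV
      (\<lambda>t. 1 / 2 * ln (1 / (a - 1) * (sqrt (exp (2 / m * t) + (a\<^sup>2 - 1)) + (-1) * exp (1 / m * t))))"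
    by (rule mul)
  moreover have "flow_distance a m =
      (\<lambda>t. 1 / 2 * ln (1 / (a - 1) * (sqrt (exp (2 / m * t) + (a\<^sup>2 - 1)) + (-1) * exp (1 / m * t))))"
    by (simp add: fun_eq_iff flow_distance_def flow_radicand_def add_diff_eq)
  ultimately show ?thesis by (simp only: Ck_on_Suc_imp)
qed

lemma flow_distance_at_bot:
  "(flow_distance a m \<longlongrightarrow> ln (sqrt (a\<^sup>2 - 1) / (a - 1)) / 2) at_bot"
proof -
  have "filterlim (\<lambda>t. (1 / m) * t) at_bot at_bot"
    by (rule filterlim_tendsto_pos_mult_at_bot[OF tendsto_const _ filterlim_ident]) (use m in simp)
  then have E: "((\<lambda>t. exp (t / m)) \<longlongrightarrow> 0) at_bot"
    by (intro filterlim_compose[OF exp_at_bot]) simp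
  have "((\<lambda>t. ln ((sqrt ((exp (t / m))\<^sup>2 + (a\<^sup>2 - 1)) - exp (t / m)) / (a - 1)) / 2)
      \<longlongrightarrow> ln ((sqrt (0\<^sup>2 + (a\<^sup>2 - 1)) - 0) / (a - 1)) / 2) at_bot"
  proof (intro tendsto_intros E)
    have "a\<^sup>2 \<noteq> 1" using square_minus_one_pos by linarith
    then show "(sqrt (0\<^sup>2 + (a\<^sup>2 - 1)) - 0) / (a - 1) \<noteq> 0" using a by simp
  qed (use a in auto)
  then show ?thesis by (simp add: flow_distance_def[abs_def] radicand_eq)
qed

lemma flow_distance_at_top: "filterlim (flow_distance a m) at_bot at_top"
proof -
  have "exp (2 * flow_distance a m t) \<le> exp (ln (a + 1) - t / m)" for t
  proof -
    have "exp (- (2 * flow_distance a m t)) \<ge> exp (t / m) / (a + 1)"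
      unfolding exp_flow_distance using a radicand_pos[of t] by (intro divide_right_mono) auto
    then show ?thesis
      using a by (simp add: exp_minus exp_diff field_simps)
  qed
  then have le: "flow_distance a m t \<le> (ln (a + 1) - t / m) / 2" for t
    by (simp add: field_simps)
  have "filterlim (\<lambda>t. (ln (a + 1) - t / m) / 2) at_bot at_top"
  proof -
    have "filterlim (\<lambda>t. (1 / (2 * m)) * t) at_top at_top"
      using m by (intro filterlim_tendsto_pos_mult_at_top[OF tendsto_const] filterlim_ident) auto
    then have "filterlim (\<lambda>t. - (ln (a + 1) / 2) + (1 / (2 * m)) * t) at_top at_top"
      by (rule filterlim_tendsto_add_at_top[OF tendsto_const])
    moreover have "- (ln (a + 1) / 2) + (1 / (2 * m)) * t = - ((ln (a + 1) - t / m) / 2)" for t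
      using m by (simp add: field_simps)
    ultimately show ?thesis
      unfolding filterlim_uminus_at_bot by (simp only:)
  qed
  then show ?thesis
    by (rule filterlim_at_bot_mono) (use le in auto)
qed

end

section \<open>Inverse mean curvature flow of a cylinder\<close>

lemma has_vector_derivative_parallel:
  fixes X Y :: "'a::real_normed_vector"
  assumes "(\<nu> has_real_derivative \<nu>') (at t)"
  shows "((\<lambda>u. cosh (\<nu> u) *\<^sub>R X + sinh (\<nu> u) *\<^sub>R Y) has_vector_derivative
    \<nu>' *\<^sub>R (sinh (\<nu> t) *\<^sub>R X + cosh (\<nu> t) *\<^sub>R Y)) (at t)"
proof -
  have c: "((\<lambda>u. cosh (\<nu> u)) has_real_derivative \<nu>' * sinh (\<nu> t)) (at t)"
    and s: "((\<lambda>u. sinh (\<nu> u)) has_real_derivative \<nu>' * cosh (\<nu> t)) (at t)"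
    by (auto intro!: derivative_eq_intros assms)
  from has_vector_derivative_add[OF has_vector_derivative_scaleR[OF c has_vector_derivative_const]
      has_vector_derivative_scaleR[OF s has_vector_derivative_const], of X Y]
  show ?thesis by (simp add: scaleR_add_right)
qed

text \<open>In particular the norm depends on the time coordinate only.\<close>

lemma norm_ball_model:
  fixes x :: "real \<times> ((real ^ 'n) \<times> real)"
  assumes "x \<in> hyperbolic_space"
  shows "norm (ball_model x) = sqrt (1 - 2 / (fst x + 1))"
proof -
  have x: "fst x > 0" "(fst x)\<^sup>2 = 1 + (norm (snd x))\<^sup>2" using hyperbolic_spaceD[OF assms] by auto
  have n: "norm (fst (snd x), - snd (snd x)) = norm (snd x)"
    by (simp add: norm_prod_def)
  have "norm (ball_model x) = norm (snd x) / (fst x + 1)"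
    using x(1) by (simp only: ball_model_def norm_scaleR n) simp
  moreover have "(norm (snd x) / (fst x + 1))\<^sup>2 = 1 - 2 / (fst x + 1)"
  proof -
    have "(norm (snd x))\<^sup>2 = (fst x - 1) * (fst x + 1)" using x(2) by (simp add: algebra_simps power2_eq_square)
    then have "(norm (snd x) / (fst x + 1))\<^sup>2 = (fst x - 1) / (fst x + 1)"
      using x(1) by (simp only: power_divide) (simp add: power2_eq_square)
    then show ?thesis using x(1) by (simp add: divide_simps)
  qed
  ultimately show ?thesis
    using x(1) by (metis abs_of_nonneg real_sqrt_abs norm_ge_zero)
qed

locale cylinder_flow = hyperbolic_cylinder F N k\<^sub>1 k\<^sub>2 r s
  for F N :: "'m::finite amb \<Rightarrow> real \<times> 'a::euclidean_space" and k\<^sub>1 k\<^sub>2 r s :: real +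
  fixes a m :: real
  assumes a_eq: "a = (k\<^sub>1 + k\<^sub>2) / 2" and m_eq: "m = real CARD('m)"
begin

lemma a_gt_1: "a > 1"
proof -
  have "0 < (k\<^sub>1 - 1) * (1 - k\<^sub>2)" using k\<^sub>1 k\<^sub>2 by simp
  then show ?thesis unfolding a_eq using k12 by (simp add: algebra_simps)
qed

lemma parallel_mean_curvature:
  assumes "cosh \<sigma> - k\<^sub>1 * sinh \<sigma> \<noteq> 0" "p \<in> SH"
  shows "mean_curvature (parallel \<sigma>) (parallel_normal \<sigma>) p
    = 2 * m * (a * cosh (2 * \<sigma>) - sinh (2 * \<sigma>))
      / (cosh (2 * \<sigma>) - a * sinh (2 * \<sigma>))"
  by (simp add: curvature_sum[OF assms(1), folded a_eq] parallel_curvatures(4)[OF assms, folded m_eq])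

lemma nonfocal_if_pos:
  assumes "cosh (2 * \<sigma>) - a * sinh (2 * \<sigma>) > 0"
  shows "cosh \<sigma> - k\<^sub>1 * sinh \<sigma> \<noteq> 0"
  using assms nonfocal_factors[of \<sigma>, folded a_eq] by auto

abbreviation \<mu> where "\<mu> \<equiv> flow_distance a m"

lemma m_pos: "m > 0"
  by (simp add: m_eq)

lemma flow_nonfocal: "cosh (\<mu> t) - k\<^sub>1 * sinh (\<mu> t) \<noteq> 0"
  by (rule nonfocal_if_pos) (simp add: flow_distance_products(1)[OF a_gt_1 m_pos])

lemma flow_mean_curvature:
  assumes "p \<in> SH"
  shows "mean_curvature (parallel (\<mu> t)) (parallel_normal (\<mu> t)) p
    = 2 * m * sqrt (flow_radicand a (m) t) / exp (t / m)"
  unfolding parallel_mean_curvature[OF flow_nonfocal assms]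
    flow_distance_products[OF a_gt_1 m_pos] ..

lemma flow_solution:
  "parallel_imcf_solution UNIV F N \<mu> (\<lambda>t. parallel (\<mu> t)) (\<lambda>t. parallel_normal (\<mu> t))"
  unfolding parallel_imcf_solution_def imcf_solution_def
proof (intro conjI ballI)
  show "smooth_on UNIV \<mu>"
    unfolding smooth_on_def
    by (intro ballI exI[of _ UNIV] exI[of _ \<mu>]) (simp add: Ck_on_flow_distance[OF a_gt_1 m_pos])
  fix p :: "'m amb" assume p: "p \<in> SH"
  show "parallel (\<mu> 0) p = F p"
    by (simp add: parallel_def flow_distance_zero[OF a_gt_1 m_pos])
  fix t :: real
  show "parallel (\<mu> t) p = cosh (\<mu> t) *\<^sub>R F p + sinh (\<mu> t) *\<^sub>R N p" by (simp add: parallel_def)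
  have "- exp (t / m) / (2 * m * sqrt (flow_radicand a (m) t))
      = - (1 / mean_curvature (parallel (\<mu> t)) (parallel_normal (\<mu> t)) p)"
    by (simp add: flow_mean_curvature[OF p])
  with has_vector_derivative_parallel[OF flow_distance_derivative[OF a_gt_1 m_pos, of t],
      where X = "F p" and Y = "N p"]
  show "((\<lambda>s. parallel (\<mu> s) p) has_vector_derivative
      - (1 / mean_curvature (parallel (\<mu> t)) (parallel_normal (\<mu> t)) p) *\<^sub>R parallel_normal (\<mu> t) p) (at t)"
    by (simp only: parallel_def parallel_normal_def)
next
  fix t :: real
  show "hypersurface (parallel (\<mu> t))" by (rule parallel_hypersurface[OF flow_nonfocal])
  show "inward_unit_normal (parallel (\<mu> t)) (parallel_normal (\<mu> t))"
    using radicand_pos[OF a_gt_1 m_pos, of t] m_pos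
    by (auto simp: inward_unit_normal_def parallel_unit_normal[OF flow_nonfocal] flow_mean_curvature)
qed auto

lemma SH_nonempty: "((1, 0), (1, 0)) \<in> (SH :: 'm amb set)"
  by (simp add: mem_SH hyperbolic_space_def lorentz_def norm_prod_def)

text \<open>Along any solution the quantity \<open>cosh 2\<nu> - a sinh 2\<nu>\<close> obeys \<open>u' = u / m\<close>; it determines \<open>\<nu>\<close>. The
  given solution may carry the opposite unit normal, but the sign then occurs in \<open>H\<close> too and cancels
  in \<open>N / H\<close>.\<close>

lemma flow_unique:
  fixes Gt Mt :: "real \<Rightarrow> 'm amb \<Rightarrow> real \<times> 'a"
  assumes sol: "parallel_imcf_solution I F N \<nu> Gt Mt" and "t \<in> I"
  shows "\<nu> t = \<mu> t"
proof -
  let ?u = "\<lambda>t. cosh (2 * \<nu> t) - a * sinh (2 * \<nu> t)"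
  define p :: "'m amb" where "p = ((1, 0), (1, 0))"
  have p: "p \<in> SH" unfolding p_def by (rule SH_nonempty)
  have I: "open I" "is_interval I" "0 \<in> I" and G0: "Gt 0 p = F p" and sm: "smooth_on I \<nu>"
    and G: "\<And>t p. t \<in> I \<Longrightarrow> p \<in> SH \<Longrightarrow> Gt t p = parallel (\<nu> t) p"
    and hyp: "\<And>t. t \<in> I \<Longrightarrow> hypersurface (Gt t)"
    and inw: "\<And>t. t \<in> I \<Longrightarrow> unit_normal (Gt t) (Mt t)"
    "\<And>t. t \<in> I \<Longrightarrow> mean_curvature (Gt t) (Mt t) p > 0"
    and flow: "\<And>t. t \<in> I \<Longrightarrow> ((\<lambda>s. Gt s p) has_vector_derivative
           - (1 / mean_curvature (Gt t) (Mt t) p) *\<^sub>R Mt t p) (at t)"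
    using sol p by (auto simp: parallel_imcf_solution_def imcf_solution_def inward_unit_normal_def
        parallel_def)
  have \<nu>0: "\<nu> 0 = 0"
  proof -
    have "lorentz (parallel (\<nu> 0) p) (N p) = lorentz (F p) (N p)" using G0 G[OF I(3) p] by simp
    then show ?thesis by (simp add: parallel_def lorentz_bilinear frame_products[OF p])
  qed
  have du: "(?u has_real_derivative ?u t / m) (at t)" if t: "t \<in> I" for t
  proof -
    have "(\<nu> has_derivative frechet_derivative \<nu> (at t within I)) (at t)"
      using smooth_on_has_derivative[OF sm t] at_within_open[OF t I(1)] by simp
    then have "\<nu> differentiable (at t)" by (rule differentiableI)
    then obtain \<nu>' where \<nu>': "(\<nu> has_real_derivative \<nu>') (at t)"
      unfolding real_differentiable_def by blast
    have nf: "cosh (\<nu> t) - k\<^sub>1 * sinh (\<nu> t) \<noteq> 0"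
      by (rule nonfocal_of_hypersurface[OF hyp[OF t] G[OF t] p])
    obtain \<epsilon> where \<epsilon>: "\<epsilon>\<^sup>2 = 1" "Mt t p = \<epsilon> *\<^sub>R parallel_normal (\<nu> t) p"
      "mean_curvature (Gt t) (Mt t) p
        = m * (\<epsilon> * (curvature k\<^sub>1 (\<nu> t) + curvature k\<^sub>2 (\<nu> t)))"
      using any_unit_normal[OF nf hyp[OF t] G[OF t] inw(1)[OF t] p, folded m_eq] by metis
    let ?K = "curvature k\<^sub>1 (\<nu> t) + curvature k\<^sub>2 (\<nu> t)"
    have "\<epsilon> \<noteq> 0" using \<epsilon>(1) by auto
    have K: "?K \<noteq> 0" using inw(2)[OF t] \<epsilon>(3) by auto
    have "((\<lambda>s. Gt s p) has_vector_derivative \<nu>' *\<^sub>R parallel_normal (\<nu> t) p) (at t)"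
      unfolding parallel_normal_def
      by (rule has_vector_derivative_transform_within_open[OF has_vector_derivative_parallel[OF \<nu>'] I(1) t])
        (simp add: G p parallel_def)
    from vector_derivative_unique_at[OF this flow[OF t]]
    have "\<nu>' *\<^sub>R parallel_normal (\<nu> t) p = - (1 / (m * ?K)) *\<^sub>R parallel_normal (\<nu> t) p"
      unfolding \<epsilon>(3) \<epsilon>(2) using \<open>\<epsilon> \<noteq> 0\<close> by simp
    then have "lorentz (parallel_normal (\<nu> t) p) (\<nu>' *\<^sub>R parallel_normal (\<nu> t) p)
        = lorentz (parallel_normal (\<nu> t) p) (- (1 / (m * ?K)) *\<^sub>R parallel_normal (\<nu> t) p)"
      by simp
    then have \<nu>'K: "\<nu>' = - (1 / (m * ?K))"
      by (simp add: lorentz_bilinear parallel_normal_products[OF p])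
    let ?w = "a * cosh (2 * \<nu> t) - sinh (2 * \<nu> t)"
    have Ke: "?K = 2 * ?w / ?u t" by (rule curvature_sum[OF nf, folded a_eq])
    have nz: "?w \<noteq> 0" "?u t \<noteq> 0" using K unfolding Ke by auto
    have "(?u has_real_derivative - (2 * \<nu>' * ?w)) (at t)"
      by (rule derivative_eq_intros \<nu>' refl | simp add: algebra_simps)+
    moreover have "- (2 * \<nu>' * ?w) = ?u t / m"
    proof -
      have "- (2 * - (1 / (m * (2 * w / u))) * w) = u / m" if "w \<noteq> 0" "u \<noteq> 0" for u w
        using that m_pos by (simp add: field_simps)
      from this[OF nz] show ?thesis unfolding \<nu>'K Ke .
    qed
    ultimately show ?thesis by simp
  qed
  have "\<exists>c. \<forall>t\<in>I. ?u t * exp (- t / m) = c"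
  proof (rule has_field_derivative_zero_constant)
    show "convex I" using I(2) by (simp add: is_interval_convex)
    show "((\<lambda>t. ?u t * exp (- t / m)) has_real_derivative 0) (at t within I)" if "t \<in> I" for t
    proof (rule DERIV_subset)
      have "((\<lambda>t. exp (- t / m)) has_real_derivative - (exp (- t / m) / m)) (at t)"
        using m_pos by (auto intro!: derivative_eq_intros)
      from DERIV_mult[OF du[OF that] this]
      show "((\<lambda>t. ?u t * exp (- t / m)) has_real_derivative 0) (at t)" by simp
    qed auto
  qed
  then have "?u t * exp (- t / m) = ?u 0 * exp (- 0 / m)" using I(3) \<open>t \<in> I\<close> by metis
  then have "?u t = exp (t / m)" by (simp add: \<nu>0 exp_minus field_simps)
  then have "?u t = cosh (2 * \<mu> t) - a * sinh (2 * \<mu> t)"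
    by (simp only: flow_distance_products[OF a_gt_1 m_pos])
  from cosh_sinh_eq_inj[OF a_gt_1 this] show ?thesis by simp
qed

text \<open>The limit distance \<open>\<theta>\<close> satisfies \<open>e\<^sup>2\<^sup>\<theta> = (k\<^sub>1 - k\<^sub>2) / (k\<^sub>1 + k\<^sub>2 - 2) = (k\<^sub>1 + 1) / (k\<^sub>1 - 1)\<close>, which
  is the focal distance \<open>coth \<theta> = k\<^sub>1\<close>.\<close>

lemma flow_limit:
  "converges_to_submanifold CARD('m) (\<lambda>t. parallel (\<mu> t)) at_bot"
proof -
  define \<theta> where "\<theta> = ln (sqrt (a\<^sup>2 - 1) / (a - 1)) / 2"
  have "a\<^sup>2 - k\<^sub>1 * k\<^sub>2 = ((k\<^sub>1 - k\<^sub>2) / 2)\<^sup>2" by (simp add: a_eq power2_eq_square field_simps)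
  have pos: "k\<^sub>1 + k\<^sub>2 - 2 > 0" using a_gt_1 by (simp add: a_eq)
  have "sqrt (a\<^sup>2 - 1) = (k\<^sub>1 - k\<^sub>2) / 2"
    using \<open>a\<^sup>2 - k\<^sub>1 * k\<^sub>2 = ((k\<^sub>1 - k\<^sub>2) / 2)\<^sup>2\<close> k12 k\<^sub>1 k\<^sub>2 by simp
  moreover have "a - 1 = (k\<^sub>1 + k\<^sub>2 - 2) / 2" by (simp add: a_eq field_simps)
  ultimately have "sqrt (a\<^sup>2 - 1) / (a - 1) = (k\<^sub>1 - k\<^sub>2) / (k\<^sub>1 + k\<^sub>2 - 2)"
    by (simp only:) (simp add: divide_simps, simp add: algebra_simps)
  then have "2 * \<theta> = ln ((k\<^sub>1 - k\<^sub>2) / (k\<^sub>1 + k\<^sub>2 - 2))" by (simp add: \<theta>_def)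
  then have e: "exp (2 * \<theta>) = (k\<^sub>1 - k\<^sub>2) / (k\<^sub>1 + k\<^sub>2 - 2)"
    using pos k\<^sub>1 k\<^sub>2 by simp
  have "exp (2 * \<theta>) + 1 = k\<^sub>1 * (exp (2 * \<theta>) - 1)"
    unfolding e using pos k12 by (simp add: divide_simps) (simp add: algebra_simps)
  then have "exp \<theta> * (exp \<theta> + exp (- \<theta>)) = exp \<theta> * (k\<^sub>1 * (exp \<theta> - exp (- \<theta>)))"
    by (simp add: algebra_simps exp_double power2_eq_square flip: exp_add)
  then have \<theta>: "cosh \<theta> = k\<^sub>1 * sinh \<theta>" by (simp add: cosh_def sinh_def)
  have lim: "(\<mu> \<longlongrightarrow> \<theta>) at_bot"
    unfolding \<theta>_def by (rule flow_distance_at_bot[OF a_gt_1 m_pos])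
  have "((\<lambda>t. parallel (\<mu> t) p) \<longlongrightarrow> parallel \<theta> p) at_bot" for p
    unfolding parallel_def by (intro tendsto_intros tendsto_cosh tendsto_sinh lim)
  then show ?thesis
    unfolding converges_to_submanifold_def
    using parallel_smooth(1) focal_rank[OF \<theta>] parallel_hyperbolic focal_submanifold[OF \<theta>]
    by (intro exI[of _ "parallel \<theta>"]) auto
qed

text \<open>Expanded in exponentials, the coefficient of \<open>e\<^sup>-\<^sup>\<nu>\<close> is half the time component of the lightlike
  vector \<open>F - N\<close>, and this vector points to the future.\<close>

lemma time_component_diverges:
  assumes p: "p \<in> SH" and \<nu>: "filterlim \<nu> at_bot flt"
  shows "filterlim (\<lambda>t. fst (parallel (\<nu> t) p)) at_top flt"
proof -
  have F: "fst (F p) > 0" using position_hyperbolic[OF p] by (simp add: hyperbolic_space_def)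
  have less: "\<bar>fst (N p)\<bar> < fst (F p)"
  proof (rule power2_less_imp_less)
    let ?x = "fst (F p)" and ?n = "fst (N p)"
    have "?x\<^sup>2 = 1 + (norm (snd (F p)))\<^sup>2" using hyperbolic_spaceD[OF position_hyperbolic[OF p]] by simp
    moreover have "(norm (snd (N p)))\<^sup>2 = 1 + ?n\<^sup>2"
      using frame_products(2)[OF p] by (simp add: lorentz_def power2_eq_square dot_square_norm)
    moreover have "(?n * ?x)\<^sup>2 \<le> (norm (snd (N p)))\<^sup>2 * (norm (snd (F p)))\<^sup>2"
    proof -
      have "?n * ?x = snd (N p) \<bullet> snd (F p)"
        using frame_products(3)[OF p] by (simp add: lorentz_def)
      then show ?thesis
        using Cauchy_Schwarz_ineq[of "snd (N p)" "snd (F p)"] by (simp add: dot_square_norm)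
    qed
    ultimately have "(?n * ?x)\<^sup>2 \<le> (1 + ?n\<^sup>2) * (?x\<^sup>2 - 1)" by simp
    then show "\<bar>?n\<bar>\<^sup>2 < ?x\<^sup>2" by (simp add: power_mult_distrib algebra_simps)
  qed (use F in simp)
  have bound: "(fst (F p) - fst (N p)) / 2 * exp (- \<sigma>) \<le> fst (parallel \<sigma> p)" for \<sigma>
  proof -
    have "fst (parallel \<sigma> p) = (fst (F p) - fst (N p)) / 2 * exp (- \<sigma>) + (fst (F p) + fst (N p)) / 2 * exp \<sigma>"
      by (simp add: parallel_def cosh_def sinh_def field_simps)
    then show ?thesis using less by simp
  qed
  have "filterlim (\<lambda>t. - \<nu> t) at_top flt" using \<nu> by (simp add: filterlim_uminus_at_top)
  then have e: "filterlim (\<lambda>t. exp (- \<nu> t)) at_top flt" by (rule filterlim_compose[OF exp_at_top])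
  have "filterlim (\<lambda>t. (fst (F p) - fst (N p)) / 2 * exp (- \<nu> t)) at_top flt"
    by (rule filterlim_tendsto_pos_mult_at_top[OF tendsto_const _ e]) (use less in auto)
  then show ?thesis
    by (rule filterlim_at_top_mono) (use bound in auto)
qed

end

theorem theorem3p5:
  fixes F N :: "'m::finite amb \<Rightarrow> real \<times> ((real ^ 'n) \<times> real)"
    and m n :: nat and k\<^sub>1 k\<^sub>2 a :: real and q :: "real \<Rightarrow> real"
  assumes "m = CARD('m)" and "n = CARD('n)" and "n = 2 * m"
    and "cylinder F N k\<^sub>1 k\<^sub>2" and "inward_unit_normal F N"
    and "k\<^sub>1 > 1" and "k\<^sub>1 * k\<^sub>2 = 1"
    and "a = (k\<^sub>1 + k\<^sub>2) / 2"
    and "\<And>t. q t = exp (2 * t / real m) + a\<^sup>2 - 1"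
  shows "(\<forall>p\<in>SH. a = mean_curvature F N p / real n) \<and>
    (\<exists>\<mu> Ft Nt.
      (\<forall>t. cosh (2 * \<mu> t) = (- exp (t / real m) + a * sqrt (q t)) / (a\<^sup>2 - 1)) \<and>
      (\<forall>t. sinh (2 * \<mu> t) = (- a * exp (t / real m) + sqrt (q t)) / (a\<^sup>2 - 1)) \<and>
      Ft = (\<lambda>t p. cosh (\<mu> t) *\<^sub>R F p + sinh (\<mu> t) *\<^sub>R N p) \<and>
      Nt = (\<lambda>t p. sinh (\<mu> t) *\<^sub>R F p + cosh (\<mu> t) *\<^sub>R N p) \<and>
      parallel_imcf_solution UNIV F N \<mu> Ft Nt \<and>
      (\<forall>I \<nu> Gt Mt. parallel_imcf_solution I F N \<nu> Gt Mt \<longrightarrow>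
         (\<forall>t\<in>I. \<nu> t = \<mu> t \<and> (\<forall>p\<in>SH. Gt t p = Ft t p))) \<and>
      (\<forall>t. \<exists>k\<^sub>1t k\<^sub>2t. cylinder (Ft t) (Nt t) k\<^sub>1t k\<^sub>2t \<and> k\<^sub>1t * k\<^sub>2t = 1) \<and>
      converges_to_submanifold m Ft at_bot \<and>
      converges_to_boundary Ft at_top)"
proof -
  obtain r s where rs: "r > 0" "s > 0"
    "\<forall>p\<in>SH. \<forall>v\<in>tangent p. \<forall>w\<in>tangent p. induced_metric F p v w = product_metric r s v w"
    using assms(4) unfolding cylinder_def by blast
  interpret cylinder_flow F N k\<^sub>1 k\<^sub>2 r s a "real m"
    by unfold_locales (use assms rs in auto)
  have q: "q t = flow_radicand a (real m) t" for t
    by (simp add: assms(9) flow_radicand_def)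
  have mc: "a = mean_curvature F N p / real n" if "p \<in> SH" for p
  proof -
    have "mean_curvature F N p = (\<Sum>k\<in>{k\<^sub>1, k\<^sub>2}. real CARD('m) * k)"
      using assms(4) that by (auto simp: mean_curvature_def cylinder_def)
    moreover have "k\<^sub>1 \<noteq> k\<^sub>2" using k\<^sub>1 k\<^sub>2 by simp
    ultimately have "mean_curvature F N p = real CARD('m) * (k\<^sub>1 + k\<^sub>2)" by (simp add: distrib_left)
    then show ?thesis by (simp add: assms(3,1,8) del: of_nat_0_less_iff)
  qed
  have boundary: "converges_to_boundary (\<lambda>t. parallel (\<mu> t)) at_top"
    unfolding converges_to_boundary_def
  proof
    fix p :: "'m amb" assume p: "p \<in> SH"
    have "filterlim (\<lambda>t. 1 + fst (parallel (\<mu> t) p)) at_top at_top"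
      by (intro filterlim_tendsto_add_at_top[OF tendsto_const]
          time_component_diverges[OF p] flow_distance_at_top[OF a_gt_1 m_pos])
    then have "((\<lambda>t. 2 / (1 + fst (parallel (\<mu> t) p))) \<longlongrightarrow> 0) at_top"
      by (rule tendsto_divide_0[OF tendsto_const filterlim_at_top_imp_at_infinity])
    then have "((\<lambda>t. sqrt (1 - 2 / (1 + fst (parallel (\<mu> t) p)))) \<longlongrightarrow> sqrt (1 - 0)) at_top"
      by (intro tendsto_intros)
    then show "((\<lambda>t. norm (ball_model (parallel (\<mu> t) p))) \<longlongrightarrow> 1) at_top"
      by (simp add: norm_ball_model[OF parallel_hyperbolic[OF p]] add.commute)
  qed
  show ?thesis
  proof (rule conjI, blast intro: mc, rule exI[of _ \<mu>], rule exI[of _ "\<lambda>t. parallel (\<mu> t)"],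
      rule exI[of _ "\<lambda>t. parallel_normal (\<mu> t)"], intro conjI allI ballI impI)
    fix t
    show "cosh (2 * \<mu> t) = (- exp (t / real m) + a * sqrt (q t)) / (a\<^sup>2 - 1)"
      unfolding q by (rule cosh_flow_distance[OF a_gt_1 m_pos])
    show "sinh (2 * \<mu> t) = (- a * exp (t / real m) + sqrt (q t)) / (a\<^sup>2 - 1)"
      unfolding q by (rule sinh_flow_distance[OF a_gt_1 m_pos])
    show "\<exists>k\<^sub>1t k\<^sub>2t. cylinder (parallel (\<mu> t)) (parallel_normal (\<mu> t)) k\<^sub>1t k\<^sub>2t \<and> k\<^sub>1t * k\<^sub>2t = 1"
      using parallel_cylinder[OF flow_nonfocal] curvature_product[OF flow_nonfocal] by blast
  next
    fix I \<nu> t and Gt Mt :: "real \<Rightarrow> 'm amb \<Rightarrow> real \<times> ((real ^ 'n) \<times> real)"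
    assume sol: "parallel_imcf_solution I F N \<nu> Gt Mt" and t: "t \<in> I"
    show e: "\<nu> t = \<mu> t" by (rule flow_unique[OF sol t])
    show "Gt t p = parallel (\<mu> t) p" if "p \<in> SH" for p
      using sol t that by (simp add: parallel_imcf_solution_def parallel_def flip: e)
  next
    show "converges_to_submanifold m (\<lambda>t. parallel (\<mu> t)) at_bot"
      using flow_limit by (simp flip: assms(1))
    show "parallel_imcf_solution UNIV F N \<mu> (\<lambda>t. parallel (\<mu> t)) (\<lambda>t. parallel_normal (\<mu> t))"
      by (rule flow_solution)
    show "converges_to_boundary (\<lambda>t. parallel (\<mu> t)) at_top" by (rule boundary)
  qed (simp_all add: parallel_def[abs_def] parallel_normal_def[abs_def])
qed

end
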